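(* Let $\mathcal{X}$ and $\mathcal{Y}$ be metric spaces, $\mathcal{F}=\mathcal{B}(\mathcal{X})$ and $\mathcal{G}=\mathcal{B}(\mathcal{Y})$ their Borel $\sigma$-fields, $\mu$ a probability measure on $\mathcal{F}$ and $\nu$ a probability measure on $\mathcal{G}$. Let $c:\mathcal{X}\times\mathcal{Y}\rightarrow\mathbb{R}$ be a function such that $f_1+g_1\le c\le f_2+g_2$ everywhere on $\mathcal{X}\times\mathcal{Y}$ for some $f_1,f_2\in L_1(\mu)$ and $g_1,g_2\in L_1(\nu)$. Suppose that the map $x\mapsto c(x,y)$ is $\mathcal{F}$-measurable for each $y\in\mathcal{Y}$ and the map $y\mapsto c(x,y)$ is continuous for each $x\in\mathcal{X}$. Then: (j) $\alpha^*(c)=\beta^*(c)$ if $c$ is bounded below and $\nu$ is separable; (jj) $\alpha(c)=\beta(c)$ if $c$ is bounded above and $\nu$ is separable; (jjj) $\alpha(c)=\beta(c)$ and $\alpha^*(c)=\beta^*(c)$ if $c$ is bounded and $\nu$ is separable.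
   Context: Let $\mathcal{H}=\mathcal{F}\otimes\mathcal{G}$ be the product $\sigma$-field on $\mathcal{X}\times\mathcal{Y}$ and $\Gamma(\mu,\nu)$ the set of ($\sigma$-additive) probability measures $P$ on $\mathcal{H}$ with marginals $\mu$ and $\nu$, i.e. $P(A\times\mathcal{Y})=\mu(A)$ and $P(\mathcal{X}\times B)=\nu(B)$ for all $A\in\mathcal{F}$, $B\in\mathcal{G}$. $L_1(\mu)$ is the class of $\mathcal{F}$-measurable, $\mu$-integrable functions $\mathcal{X}\to\mathbb{R}$ (real-valued, not identified when a.s. equal); similarly $L_1(\nu)$. Write $\mu(f)=\int f\,d\mu$, and similarly for other measures. For $f:\mathcal{X}\to\mathbb{R}$ and $g:\mathcal{Y}\to\mathbb{R}$, $f+g$ denotes the function $(x,y)\mapsto f(x)+g(y)$ on $\mathcal{X}\times\mathcal{Y}$. Let $L=\{f+g: f\in L_1(\mu),\ g\in L_1(\nu)\}$. A Borel probability measure on a metric space is separable if it gives measure $1$ to some separable Borel set. The function $c$ is not required to be $\mathcal{H}$-measurable. In each of the cases considered there are $A\in\mathcal{F}$, $B\in\mathcal{G}$ with $\mu(A)=\nu(B)=1$ such that $c\,1_{A\times B}$ is $\mathcal{H}$-measurable, so $c$ is measurable with respect to the completion $\overline{P}$ of each $P\in\Gamma(\mu,\nu)$, and one defines $$\alpha(c)=\inf_{P\in\Gamma(\mu,\nu)}\overline{P}(c),\qquad \alpha^*(c)=\sup_{P\in\Gamma(\mu,\nu)}\overline{P}(c),$$ $$\beta(c)=\sup\{\mu(f)+\nu(g):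 f+g\in L,\ f+g\le c\},\qquad \beta^*(c)=\inf\{\mu(f)+\nu(g): f+g\in L,\ f+g\ge c\},$$ where the inequalities hold everywhere on $\mathcal{X}\times\mathcal{Y}$. *)

theory Defs
  imports "HOL-Probability.Probability"
begin

definition couplings :: "'a measure \<Rightarrow> 'b measure \<Rightarrow> ('a \<times> 'b) measure set" where
  "couplings \<mu> \<nu> =
     {P. prob_space P \<and> sets P = sets (\<mu> \<Otimes>\<^sub>M \<nu>) \<and>
         (\<forall>A\<in>sets \<mu>. emeasure P (A \<times> space \<nu>) = emeasure \<mu> A) \<and>
         (\<forall>B\<in>sets \<nu>. emeasure P (space \<mu> \<times> B) = emeasure \<nu> B)}"

definition separable_measure :: "'a::metric_space measure \<Rightarrow> bool" where
  "separable_measure \<nu> \<longleftrightarrow>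
     (\<exists>S\<in>sets borel. separable_space (top_of_set S) \<and> emeasure \<nu> S = 1)"

text \<open>
  The cost function need not be measurable for the product sigma-algebra, only for the
  completion of each coupling, so integrals over couplings are taken with respect to the
  completion. The suprema and infima below are real-valued; they carry their usual meaning as
  soon as \<^term>\<open>c\<close> lies between two sums of integrable functions and is measurable for the
  completion of every coupling, since the sets involved are then nonempty and bounded.
\<close>

definition primal_inf :: "'a measure \<Rightarrow> 'b measure \<Rightarrow> ('a \<times> 'b \<Rightarrow> real) \<Rightarrow> real" where
  "primal_inf \<mu> \<nu> c = (INF P\<in>couplings \<mu> \<nu>. \<integral>z. c z \<partial>completion P)"

definition primal_sup :: "'a measure \<Rightarrow> 'b measure \<Rightarrow> ('a \<times> 'b \<Rightarrow> real) \<Rightarrow> real" where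
  "primal_sup \<mu> \<nu> c = (SUP P\<in>couplings \<mu> \<nu>. \<integral>z. c z \<partial>completion P)"

definition dual_sup :: "'a measure \<Rightarrow> 'b measure \<Rightarrow> ('a \<times> 'b \<Rightarrow> real) \<Rightarrow> real" where
  "dual_sup \<mu> \<nu> c =
     Sup {(\<integral>x. f x \<partial>\<mu>) + (\<integral>y. g y \<partial>\<nu>) | f g.
            integrable \<mu> f \<and> integrable \<nu> g \<and>
            (\<forall>x\<in>space \<mu>. \<forall>y\<in>space \<nu>. f x + g y \<le> c (x, y))}"

definition dual_inf :: "'a measure \<Rightarrow> 'b measure \<Rightarrow> ('a \<times> 'b \<Rightarrow> real) \<Rightarrow> real" where
  "dual_inf \<mu> \<nu> c =
     Inf {(\<integral>x. f x \<partial>\<mu>) + (\<integral>y. g y \<partial>\<nu>) | f g.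
            integrable \<mu> f \<and> integrable \<nu> g \<and>
            (\<forall>x\<in>space \<mu>. \<forall>y\<in>space \<nu>. c (x, y) \<le> f x + g y)}"

end

(*
  By truncation and negation it suffices to treat c with values in [0, M] and the equality of the
  primal supremum with the dual infimum, where only "dual <= primal" is not immediate. On the closure
  of a countable set of full nu-measure, continuity in y exhibits c as the increasing limit of costs
  h(x, kappa(y)) with kappa taking finitely many values. For such costs duality follows by
  maximising a quadratically penalised functional: the near-maximiser yields both a nearly optimal
  coupling, absolutely continuous with respect to the product measure, and a nearly optimal dual
  pair. Finally the dual pairs for the approximations converge along near-minimisers of the L2 norm;
  on the exceptional null sets the limit functions are set to M.
*)
theory Submission
  imports Defs
begin

section \<open>Costs depending on the second variable through a finite code\<close>

text \<open>The obstacle is the absence of compactness: \<open>\<mu>\<close> and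
  \<open>\<nu>\<close> need not be tight, so optimal couplings and optimal dual pairs cannot be
  extracted as weak limits. Couplings are therefore never passed to a limit. The approximating costs
  lie below \<open>c\<close> on a set of full measure for every coupling, so a coupling that is
  nearly optimal for one of them has value at most the primal supremum of \<open>c\<close>; this
  bounds the dual values along the whole sequence at once. Only dual pairs are passed to a limit:
  since the costs increase, their admissible sets decrease, which makes a minimum-norm argument
  available. Finite codes serve two ends. They reduce the constraint on the second marginal to
  finitely many numbers, which a quadratic penalty controls, and they give joint measurability from
  measurability in \<open>x\<close> alone. Dual pairs are kept in \<open>{0..M}\<close>: this
  supplies integrability and dominated convergence, and lets the value \<open>M\<close> repair null
  sets, which matters because the dual inequality must hold everywhere.\<close>

text \<open>
  \<open>\<phi> x k\<close> is the mass that \<open>x\<close> sends to \<open>k\<close>. The constraint that \<open>k\<close> receives mass \<open>q k\<close> is replaced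
  by the penalty \<open>(lam/2) \<Sum> (p k - q k)\<^sup>2\<close>; the multiplier \<open>g k = lam (p k - q k)\<close> of a near-maximiser
  is then a nearly optimal dual variable. A near-maximiser suffices, so no compactness is needed.
\<close>

lemma semidiscrete_penalty:
  fixes h :: "'a \<Rightarrow> 'k \<Rightarrow> real" and q :: "'k \<Rightarrow> real"
  assumes "prob_space \<mu>" and K: "finite K" "K \<noteq> {}"
    and h_meas: "\<And>k. k \<in> K \<Longrightarrow> (\<lambda>x. h x k) \<in> borel_measurable \<mu>"
    and h_bounds: "\<And>x k. 0 \<le> h x k" "\<And>x k. h x k \<le> M"
    and q: "\<And>k. k \<in> K \<Longrightarrow> 0 \<le> q k" "(\<Sum>k\<in>K. q k) = 1"
    and \<epsilon>: "\<epsilon> > 0"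
  obtains \<phi> :: "'a \<Rightarrow> 'k \<Rightarrow> real" and f :: "'a \<Rightarrow> real" and g :: "'k \<Rightarrow> real"
  where "\<And>k. k \<in> K \<Longrightarrow> (\<lambda>x. \<phi> x k) \<in> borel_measurable \<mu>"
    and "\<And>x k. k \<in> K \<Longrightarrow> 0 \<le> \<phi> x k" and "\<And>x. (\<Sum>k\<in>K. \<phi> x k) = 1"
    and "\<And>k. k \<in> K \<Longrightarrow> \<bar>(\<integral>x. \<phi> x k \<partial>\<mu>) - q k\<bar> \<le> \<epsilon>"
    and "f = (\<lambda>x. MAX k\<in>K. h x k - g k)"
    and "(\<integral>x. f x \<partial>\<mu>) + (\<Sum>k\<in>K. g k * q k) \<le> (\<Sum>k\<in>K. \<integral>x. h x k * \<phi> x k \<partial>\<mu>) + \<epsilon>"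
proof -
  interpret prob_space \<mu> by fact
  define \<Phi> :: "('a \<Rightarrow> 'k \<Rightarrow> real) set" where "\<Phi> = {\<phi>. (\<forall>k\<in>K. (\<lambda>x. \<phi> x k) \<in> borel_measurable \<mu>) \<and>
     (\<forall>x. \<forall>k\<in>K. 0 \<le> \<phi> x k) \<and> (\<forall>x. (\<Sum>k\<in>K. \<phi> x k) = 1)}"
  define n where "n = real (card K)"
  have n: "n \<ge> 1" using K by (auto simp: n_def Suc_le_eq card_gt_0_iff)
  have M: "M \<ge> 0" using h_bounds[of undefined undefined] by linarith
  \<comment> \<open>From \<open>J \<phi> \<ge> - d \<ge> - 1\<close> and
    \<open>V \<phi> \<le> n * M\<close> the penalty of \<open>\<phi>\<close> will be at most
    \<open>n * M + 1\<close>; this factor turns that into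
    \<open>S0 \<le> \<epsilon>\<^sup>2\<close>.\<close>
  define lam where "lam = 2 * (n * M + 1) / \<epsilon>\<^sup>2"
  have lam: "lam > 0" unfolding lam_def using n M \<epsilon> by (auto intro!: divide_pos_pos add_nonneg_pos)
  \<comment> \<open>The step length towards the competitor \<open>\<psi>\<close>: with
    \<open>t * lam * n \<le> \<epsilon>\<close> the second-order loss is at most
    \<open>t * \<epsilon> / 2\<close>.\<close>
  define t where "t = min 1 (\<epsilon> / (lam * n))"
  have t: "0 < t" "t \<le> 1" "t * lam * n \<le> \<epsilon>"
  proof -
    have ln: "lam * n > 0" using lam n by auto
    show "0 < t" "t \<le> 1" using ln \<epsilon> by (auto simp: t_def)
    have "t * (lam * n) \<le> \<epsilon> / (lam * n) * (lam * n)"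
      unfolding t_def using ln by (intro mult_right_mono) auto
    then show "t * lam * n \<le> \<epsilon>" using lam n by (simp add: mult.assoc)
  qed
  \<comment> \<open>The slack is divided by \<open>t\<close> in the slope estimate, so it has to be
    small relative to \<open>t\<close>; the bound 1 accounts for the \<open>+ 1\<close> in
    \<open>lam\<close>.\<close>
  define d where "d = min 1 (t * \<epsilon> / 2)"
  have d: "d > 0" "d \<le> 1" "d \<le> t * \<epsilon> / 2" using t \<epsilon> by (auto simp: d_def)
  define p where "p \<phi> k = (\<integral>x. \<phi> x k \<partial>\<mu>)" for \<phi> :: "'a \<Rightarrow> 'k \<Rightarrow> real" and k
  define V where "V \<phi> = (\<Sum>k\<in>K. \<integral>x. h x k * \<phi> x k \<partial>\<mu>)" for \<phi> :: "'a \<Rightarrow> 'k \<Rightarrow> real"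
  define J where "J \<phi> = V \<phi> - lam / 2 * (\<Sum>k\<in>K. (p \<phi> k - q k)\<^sup>2)" for \<phi>
  have le1: "\<phi> x k \<le> 1" if "\<phi> \<in> \<Phi>" "k \<in> K" for \<phi> x k
  proof -
    have "\<phi> x k \<le> (\<Sum>k\<in>K. \<phi> x k)" using that K by (intro member_le_sum) (auto simp: \<Phi>_def)
    then show ?thesis using that by (simp add: \<Phi>_def)
  qed
  have ge0: "0 \<le> \<phi> x k" if "\<phi> \<in> \<Phi>" "k \<in> K" for \<phi> x k
    using that by (auto simp: \<Phi>_def)
  have sum1: "(\<Sum>k\<in>K. \<phi> x k) = 1" if "\<phi> \<in> \<Phi>" for \<phi> x
    using that unfolding \<Phi>_def by blast
  have meas[measurable]: "(\<lambda>x. \<phi> x k) \<in> borel_measurable \<mu>" if "\<phi> \<in> \<Phi>" "k \<in> K" for \<phi> k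
    using that by (auto simp: \<Phi>_def)
  note [measurable] = h_meas
  have int: "integrable \<mu> (\<lambda>x. \<phi> x k)" if "\<phi> \<in> \<Phi>" "k \<in> K" for \<phi> k
    using that ge0[OF that] le1[OF that] by (intro integrable_const_bound[where B=1]) auto
  have hle: "h x k * \<phi> x k \<le> M" if "\<phi> \<in> \<Phi>" "k \<in> K" for \<phi> x k
    using mult_mono[OF h_bounds(2)[of x k] le1[OF that, of x]] M ge0[OF that, of x] by simp
  have hge: "0 \<le> h x k * \<phi> x k" if "\<phi> \<in> \<Phi>" "k \<in> K" for \<phi> x k
    using h_bounds ge0[OF that] by simp
  have hint: "integrable \<mu> (\<lambda>x. h x k * \<phi> x k)" if "\<phi> \<in> \<Phi>" "k \<in> K" for \<phi> k
    using that hle[OF that] hge[OF that] by (intro integrable_const_bound[where B=M]) auto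
  have p01: "0 \<le> p \<phi> k" "p \<phi> k \<le> 1" if "\<phi> \<in> \<Phi>" "k \<in> K" for \<phi> k
    unfolding p_def using that int[OF that] ge0[OF that] le1[OF that]
    by (auto intro!: integral_nonneg_AE integral_le_const)
  have V: "0 \<le> V \<phi>" "V \<phi> \<le> n * M" if "\<phi> \<in> \<Phi>" for \<phi>
  proof -
    show "0 \<le> V \<phi>" unfolding V_def using hge[OF that] by (intro sum_nonneg integral_nonneg_AE) auto
    have "V \<phi> \<le> (\<Sum>k\<in>K. M)" unfolding V_def
      using hle[OF that] hint[OF that] by (intro sum_mono integral_le_const) auto
    then show "V \<phi> \<le> n * M" by (simp add: n_def)
  qed
  have JV: "J \<phi> \<le> V \<phi>" for \<phi>
    unfolding J_def using lam by (simp add: sum_nonneg)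
  have bdd: "bdd_above (J ` \<Phi>)"
    using JV V(2) by (intro bdd_aboveI2[where M="n * M"]) (meson order_trans)
  \<comment> \<open>The independent kernel meets the constraint exactly, so its penalty vanishes.
    Comparing \<open>\<phi>\<close> with it bounds the penalty of \<open>\<phi>\<close>.\<close>
  define \<phi>0 where "\<phi>0 = (\<lambda>x::'a. q)"
  have \<phi>0: "\<phi>0 \<in> \<Phi>" unfolding \<phi>0_def \<Phi>_def by (simp add: q)
  have "p \<phi>0 k = q k" for k by (simp add: p_def \<phi>0_def prob_space)
  then have J0: "J \<phi>0 \<ge> 0" using V(1)[OF \<phi>0] by (simp add: J_def)
  have "\<exists>\<phi>\<in>\<Phi>. Sup (J ` \<Phi>) - d < J \<phi>"
    using less_cSup_iff[of "J ` \<Phi>" "Sup (J ` \<Phi>) - d"] bdd \<phi>0 d by auto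
  then obtain \<phi> where \<phi>: "\<phi> \<in> \<Phi>" and near: "Sup (J ` \<Phi>) - d < J \<phi>" by blast
  have opt: "J \<psi> \<le> J \<phi> + d" if "\<psi> \<in> \<Phi>" for \<psi>
    using cSUP_upper[OF that bdd] near by linarith
  define g where "g k = lam * (p \<phi> k - q k)" for k
  define f where "f = (\<lambda>x. MAX k\<in>K. h x k - g k)"
  have fle: "h x k - g k \<le> f x" if "k \<in> K" for x k
    using that K by (auto simp: f_def intro!: Max_ge)
  have fatt: "\<exists>k\<in>K. h x k - g k = f x" for x
  proof -
    have "f x \<in> (\<lambda>k. h x k - g k) ` K" unfolding f_def using K by (intro Max_in) auto
    then show ?thesis by auto
  qed
  have f_meas[measurable]: "f \<in> borel_measurable \<mu>"
    unfolding f_def using K by (intro borel_measurable_Max) auto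
  \<comment> \<open>\<open>\<psi>\<close> spreads the mass of \<open>x\<close> uniformly over the points where \<open>h x k - g k\<close> is maximal. Near-maximality
    of \<open>\<phi>\<close> along the segment towards \<open>\<psi>\<close> bounds the slope \<open>D\<close>, which is the duality gap up to the term \<open>lam S0 \<ge> 0\<close>.\<close>
  define I where "I x k = (if h x k - g k = f x then 1 else 0 :: real)" for x k
  define \<psi> where "\<psi> x k = I x k / (\<Sum>j\<in>K. I x j)" for x k
  have Ipos: "(\<Sum>j\<in>K. I x j) > 0" for x
    using fatt[of x] K by (auto simp: I_def intro!: sum_pos2)
  have [measurable]: "(\<lambda>x. I x k) \<in> borel_measurable \<mu>" if "k \<in> K" for k
    using that unfolding I_def by measurable
  have \<psi>: "\<psi> \<in> \<Phi>"
    unfolding \<Phi>_def mem_Collect_eq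
  proof (intro conjI allI ballI)
    show "(\<lambda>x. \<psi> x k) \<in> borel_measurable \<mu>" if "k \<in> K" for k
      using that unfolding \<psi>_def by measurable
    show "0 \<le> \<psi> x k" for x k
      using Ipos[of x] by (simp add: \<psi>_def I_def)
    show "(\<Sum>k\<in>K. \<psi> x k) = 1" for x
      using Ipos[of x] by (simp add: \<psi>_def sum_divide_distrib[symmetric])
  qed
  have \<psi>f: "(\<Sum>k\<in>K. (h x k - g k) * \<psi> x k) = f x" for x
  proof -
    have "(\<Sum>k\<in>K. (h x k - g k) * \<psi> x k) = (\<Sum>k\<in>K. f x * \<psi> x k)"
      by (intro sum.cong) (auto simp: \<psi>_def I_def)
    also have "\<dots> = f x" by (simp only: sum_distrib_left[symmetric] sum1[OF \<psi>] mult_1_right)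
    finally show ?thesis .
  qed
  have split: "(\<integral>x. (\<Sum>k\<in>K. (h x k - g k) * \<xi> x k) \<partial>\<mu>) = V \<xi> - (\<Sum>k\<in>K. g k * p \<xi> k)"
    if "\<xi> \<in> \<Phi>" for \<xi>
  proof -
    have "(\<integral>x. (\<Sum>k\<in>K. (h x k - g k) * \<xi> x k) \<partial>\<mu>)
        = (\<integral>x. (\<Sum>k\<in>K. h x k * \<xi> x k - g k * \<xi> x k) \<partial>\<mu>)"
      by (simp add: left_diff_distrib)
    also have "\<dots> = (\<Sum>k\<in>K. (\<integral>x. h x k * \<xi> x k \<partial>\<mu>) - g k * p \<xi> k)"
      using hint[OF that] int[OF that] by (simp add: p_def)
    finally show ?thesis by (simp add: V_def sum_subtractf)
  qed
  define \<psi>t where "\<psi>t x k = (1 - t) * \<phi> x k + t * \<psi> x k" for x k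
  have \<psi>t: "\<psi>t \<in> \<Phi>"
    unfolding \<Phi>_def mem_Collect_eq
  proof (intro conjI allI ballI)
    show "(\<lambda>x. \<psi>t x k) \<in> borel_measurable \<mu>" if "k \<in> K" for k
      using meas[OF \<phi> that] meas[OF \<psi> that] unfolding \<psi>t_def by measurable
    show "0 \<le> \<psi>t x k" if "k \<in> K" for x k
      using t ge0[OF \<phi> that, of x] ge0[OF \<psi> that, of x] by (simp add: \<psi>t_def)
    show "(\<Sum>k\<in>K. \<psi>t x k) = 1" for x
      by (simp add: \<psi>t_def sum.distrib sum_distrib_left[symmetric] sum1[OF \<phi>] sum1[OF \<psi>])
  qed
  define \<Delta> where "\<Delta> k = p \<psi> k - p \<phi> k" for k
  have pt: "p \<psi>t k = p \<phi> k + t * \<Delta> k" if "k \<in> K" for k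
    using int[OF \<phi> that] int[OF \<psi> that] by (simp add: p_def \<psi>t_def \<Delta>_def algebra_simps)
  have Vt: "V \<psi>t = V \<phi> + t * (V \<psi> - V \<phi>)"
  proof -
    have "(\<integral>x. h x k * \<psi>t x k \<partial>\<mu>) = (1 - t) * (\<integral>x. h x k * \<phi> x k \<partial>\<mu>) + t * (\<integral>x. h x k * \<psi> x k \<partial>\<mu>)"
      if "k \<in> K" for k
    proof -
      have "(\<integral>x. h x k * \<psi>t x k \<partial>\<mu>) = (\<integral>x. (1 - t) * (h x k * \<phi> x k) + t * (h x k * \<psi> x k) \<partial>\<mu>)"
        by (simp add: \<psi>t_def algebra_simps)
      then show ?thesis using hint[OF \<phi> that] hint[OF \<psi> that] by simp
    qed
    then have "V \<psi>t = (1 - t) * V \<phi> + t * V \<psi>"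
      by (simp add: V_def sum.distrib sum_distrib_left)
    then show ?thesis by (simp add: algebra_simps)
  qed
  define S1 where "S1 = (\<Sum>k\<in>K. g k * \<Delta> k)"
  define S2 where "S2 = (\<Sum>k\<in>K. (\<Delta> k)\<^sup>2)"
  define S0 where "S0 = (\<Sum>k\<in>K. (p \<phi> k - q k)\<^sup>2)"
  \<comment> \<open>\<open>J\<close> is quadratic along the segment, so the expansion is exact.
    Since \<open>g\<close> is the derivative of the penalty with respect to the masses, the
    coefficient of \<open>t\<close> is the slope named \<open>D\<close> below.\<close>
  have Jt: "J \<psi>t = J \<phi> + t * (V \<psi> - V \<phi> - S1) - t\<^sup>2 * lam / 2 * S2"
  proof -
    have "(\<Sum>k\<in>K. (p \<psi>t k - q k)\<^sup>2)
        = (\<Sum>k\<in>K. (p \<phi> k - q k)\<^sup>2 + 2 * t / lam * (g k * \<Delta> k) + t\<^sup>2 * (\<Delta> k)\<^sup>2)"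
      using lam by (intro sum.cong) (auto simp: pt g_def power2_eq_square algebra_simps)
    also have "\<dots> = S0 + 2 * t / lam * S1 + t\<^sup>2 * S2"
      by (simp add: sum.distrib sum_distrib_left S0_def S1_def S2_def)
    finally show ?thesis
      using lam by (simp add: J_def Vt S0_def[symmetric] field_simps)
  qed
  have S2: "S2 \<le> n"
  proof -
    have "(\<Delta> k)\<^sup>2 \<le> 1" if "k \<in> K" for k
      using p01[OF \<phi> that] p01[OF \<psi> that] by (auto simp: \<Delta>_def abs_square_le_1)
    then have "S2 \<le> (\<Sum>k\<in>K. 1)" unfolding S2_def by (intro sum_mono) auto
    then show ?thesis by (simp add: n_def)
  qed
  have S0: "S0 \<ge> 0" by (simp add: S0_def sum_nonneg)
  define D where "D = V \<psi> - V \<phi> - S1"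
  have D: "D \<le> \<epsilon>"
  proof -
    have "t * D \<le> d + t\<^sup>2 * lam / 2 * S2" using opt[OF \<psi>t] Jt by (simp add: D_def)
    also have "\<dots> \<le> d + t\<^sup>2 * lam / 2 * n" using S2 lam by (intro add_left_mono mult_left_mono) auto
    also have "\<dots> = d + t * (t * lam * n) / 2" by (simp add: power2_eq_square)
    also have "\<dots> \<le> t * \<epsilon> / 2 + t * \<epsilon> / 2"
      using t d by (intro add_mono divide_right_mono mult_left_mono) auto
    finally have "t * D \<le> t * \<epsilon>" by linarith
    then show ?thesis using t by simp
  qed
  have gp: "(\<Sum>k\<in>K. g k * p \<psi> k) = S1 + (\<Sum>k\<in>K. g k * p \<phi> k)"
    by (simp add: S1_def \<Delta>_def sum.distrib[symmetric] algebra_simps)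
  \<comment> \<open>Pairing \<open>g\<close> with the actual masses instead of \<open>q\<close> adds
    exactly \<open>lam * S0\<close>, which enters the final estimate with the favourable
    sign.\<close>
  have gq: "(\<Sum>k\<in>K. g k * p \<phi> k) = lam * S0 + (\<Sum>k\<in>K. g k * q k)"
    by (simp add: S0_def g_def sum.distrib[symmetric] sum_distrib_left power2_eq_square algebra_simps)
  have "(\<integral>x. f x \<partial>\<mu>) = V \<psi> - (\<Sum>k\<in>K. g k * p \<psi> k)" using split[OF \<psi>] \<psi>f by simp
  then have "(\<integral>x. f x \<partial>\<mu>) + (\<Sum>k\<in>K. g k * q k) = V \<phi> + D - lam * S0"
    using gp gq by (simp add: D_def)
  also have "\<dots> \<le> V \<phi> + \<epsilon>" using D mult_nonneg_nonneg[of lam S0] S0 lam by linarith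
  finally have fin: "(\<integral>x. f x \<partial>\<mu>) + (\<Sum>k\<in>K. g k * q k) \<le> V \<phi> + \<epsilon>" .
  have close: "\<bar>p \<phi> k - q k\<bar> \<le> \<epsilon>" if "k \<in> K" for k
  proof -
    have S0_le: "lam / 2 * S0 \<le> n * M + 1"
      using opt[OF \<phi>0] J0 V(2)[OF \<phi>] d by (simp add: J_def S0_def)
    have pos: "n * M + 1 > 0" using n M by (auto intro!: add_nonneg_pos)
    have "(n * M + 1) * (S0 / \<epsilon>\<^sup>2) = lam / 2 * S0"
      using \<epsilon> by (simp add: lam_def field_simps)
    also note S0_le
    finally have "(n * M + 1) * (S0 / \<epsilon>\<^sup>2) \<le> (n * M + 1) * 1" by (simp only: mult_1_right)
    then have "S0 / \<epsilon>\<^sup>2 \<le> 1" using pos by (simp only: mult_le_cancel_left_pos)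
    then have "S0 \<le> \<epsilon>\<^sup>2" using \<epsilon> by (simp add: divide_le_eq)
    moreover have "(p \<phi> k - q k)\<^sup>2 \<le> S0"
      unfolding S0_def using that K by (intro member_le_sum) auto
    ultimately show ?thesis using \<epsilon> by (intro abs_le_square_iff[THEN iffD2, of _ \<epsilon>, simplified abs_of_pos[OF \<epsilon>]]) auto
  qed
  show thesis
    using meas[OF \<phi>] ge0[OF \<phi>] sum1[OF \<phi>] close fin f_def
    unfolding p_def V_def by (intro that[of \<phi> f g])
qed

text \<open>A density with both marginals at most one can be topped up to exact marginals, and this
  only increases integrals of nonnegative functions. A kernel that slightly misses the second
  marginal thus yields a genuine coupling once scaled down, and the scaling is the only
  loss.\<close>

lemma subcoupling_extends:
  fixes w :: "'a \<times> 'b \<Rightarrow> ennreal"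
  assumes "prob_space \<mu>" "prob_space \<nu>"
    and w_meas[measurable]: "w \<in> borel_measurable (\<mu> \<Otimes>\<^sub>M \<nu>)"
    and w1_le: "\<And>x. x \<in> space \<mu> \<Longrightarrow> (\<integral>\<^sup>+y. w (x, y) \<partial>\<nu>) \<le> 1"
    and w2_le: "\<And>y. y \<in> space \<nu> \<Longrightarrow> (\<integral>\<^sup>+x. w (x, y) \<partial>\<mu>) \<le> 1"
  obtains P where "P \<in> couplings \<mu> \<nu>"
    and "\<And>h :: 'a \<times> 'b \<Rightarrow> ennreal. h \<in> borel_measurable (\<mu> \<Otimes>\<^sub>M \<nu>) \<Longrightarrow>
           (\<integral>\<^sup>+z. w z * h z \<partial>(\<mu> \<Otimes>\<^sub>M \<nu>)) \<le> (\<integral>\<^sup>+z. h z \<partial>P)"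
proof -
  interpret M: prob_space \<mu> by fact
  interpret N: prob_space \<nu> by fact
  interpret pair_prob_space \<mu> \<nu> ..
  define w1 where "w1 x = (\<integral>\<^sup>+y. w (x, y) \<partial>\<nu>)" for x
  define w2 where "w2 y = (\<integral>\<^sup>+x. w (x, y) \<partial>\<mu>)" for y
  have [measurable]: "w1 \<in> borel_measurable \<mu>" "w2 \<in> borel_measurable \<nu>"
    unfolding w1_def w2_def by measurable
  define m where "m = (\<integral>\<^sup>+z. w z \<partial>(\<mu> \<Otimes>\<^sub>M \<nu>))"
  define d where "d = 1 - m"
  \<comment> \<open>The missing mass is filled in by the product of the two deficits. If \<open>d = 0\<close>, both deficits
    vanish almost everywhere, so the junk value of the division is harmless.\<close>
  define \<rho> where "\<rho> z = w z + (1 - w1 (fst z)) * ((1 - w2 (snd z)) / d)" for z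
  have [measurable]: "\<rho> \<in> borel_measurable (\<mu> \<Otimes>\<^sub>M \<nu>)"
    unfolding \<rho>_def by measurable
  have m1: "m = (\<integral>\<^sup>+x. w1 x \<partial>\<mu>)" and m2: "m = (\<integral>\<^sup>+y. w2 y \<partial>\<nu>)"
    unfolding m_def w1_def w2_def using N.nn_integral_fst[OF w_meas] nn_integral_snd[OF w_meas] by auto
  have w1_le': "w1 x \<le> 1" if "x \<in> space \<mu>" for x using w1_le[OF that] by (simp add: w1_def)
  have w2_le': "w2 y \<le> 1" if "y \<in> space \<nu>" for y using w2_le[OF that] by (simp add: w2_def)
  have "m \<le> (\<integral>\<^sup>+x. 1 \<partial>\<mu>)" unfolding m1 using w1_le' by (intro nn_integral_mono) auto
  then have m_le: "m \<le> 1" by (simp add: M.emeasure_space_1)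
  then have m_fin: "m \<noteq> \<infinity>" by (auto simp: top_unique)
  have d_fin: "d \<noteq> \<infinity>" by (simp add: d_def)
  have d1: "(\<integral>\<^sup>+x. 1 - w1 x \<partial>\<mu>) = d"
    unfolding d_def m1 using m_fin w1_le' 
    by (subst nn_integral_diff) (auto simp: M.emeasure_space_1 m1 intro!: AE_I2)
  have d2: "(\<integral>\<^sup>+y. 1 - w2 y \<partial>\<nu>) = d"
    unfolding d_def m2 using m_fin w2_le' 
    by (subst nn_integral_diff) (auto simp: N.emeasure_space_1 m2 intro!: AE_I2)
  have one: "u + (1 - u) * (d / d) = 1" if "u \<le> 1" "d = 0 \<Longrightarrow> 1 - u = 0" for u :: ennreal
  proof (cases "d = 0")
    case True
    then have "1 \<le> u" using that(2) by (simp add: diff_eq_0_iff_ennreal)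
    then show ?thesis using that(1) True by auto
  next
    case False
    then show ?thesis using d_fin that(1) by (simp add: ennreal_divide_self add_diff_inverse_ennreal less_top)
  qed
  \<comment> \<open>If \<open>d = 0\<close>, a point with positive deficit keeps a section integral
    below one; such points form a null set, which the marginals do not see.\<close>
  have \<rho>1: "AE x in \<mu>. (\<integral>\<^sup>+y. \<rho> (x, y) \<partial>\<nu>) = 1"
  proof -
    have "AE x in \<mu>. d = 0 \<longrightarrow> 1 - w1 x = 0"
      using d1 by (cases "d = 0") (auto simp: nn_integral_0_iff_AE)
    then show ?thesis
    proof (rule AE_mp, intro AE_I2 impI)
      fix x assume x: "x \<in> space \<mu>" and *: "d = 0 \<longrightarrow> 1 - w1 x = 0"
      have "(\<integral>\<^sup>+y. \<rho> (x, y) \<partial>\<nu>) = w1 x + (1 - w1 x) * (d / d)"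
        unfolding \<rho>_def fst_conv snd_conv using x
        by (simp add: nn_integral_add nn_integral_cmult nn_integral_divide d2 w1_def[symmetric])
      then show "(\<integral>\<^sup>+y. \<rho> (x, y) \<partial>\<nu>) = 1" using one w1_le'[OF x] * by simp
    qed
  qed
  have \<rho>2: "AE y in \<nu>. (\<integral>\<^sup>+x. \<rho> (x, y) \<partial>\<mu>) = 1"
  proof -
    have "AE y in \<nu>. d = 0 \<longrightarrow> 1 - w2 y = 0"
      using d2 by (cases "d = 0") (auto simp: nn_integral_0_iff_AE)
    then show ?thesis
    proof (rule AE_mp, intro AE_I2 impI)
      fix y assume y: "y \<in> space \<nu>" and *: "d = 0 \<longrightarrow> 1 - w2 y = 0"
      have "(\<integral>\<^sup>+x. \<rho> (x, y) \<partial>\<mu>) = w2 y + d * ((1 - w2 y) / d)"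
        unfolding \<rho>_def fst_conv snd_conv using y
        by (simp add: nn_integral_add nn_integral_multc d1 w2_def[symmetric])
      also have "d * ((1 - w2 y) / d) = (1 - w2 y) * (d / d)"
        by (simp add: divide_ennreal_def ac_simps)
      finally show "(\<integral>\<^sup>+x. \<rho> (x, y) \<partial>\<mu>) = 1" using one w2_le'[OF y] * by simp
    qed
  qed
  define P where "P = density (\<mu> \<Otimes>\<^sub>M \<nu>) \<rho>"
  have PA: "emeasure P (A \<times> space \<nu>) = emeasure \<mu> A" if A[measurable]: "A \<in> sets \<mu>" for A
  proof -
    have "emeasure P (A \<times> space \<nu>) = (\<integral>\<^sup>+z. \<rho> z * indicator (A \<times> space \<nu>) z \<partial>(\<mu> \<Otimes>\<^sub>M \<nu>))"
      unfolding P_def by (intro emeasure_density) auto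
    also have "\<dots> = (\<integral>\<^sup>+x. \<integral>\<^sup>+y. \<rho> (x, y) * indicator (A \<times> space \<nu>) (x, y) \<partial>\<nu> \<partial>\<mu>)"
      by (intro N.nn_integral_fst[symmetric]) auto
    also have "\<dots> = (\<integral>\<^sup>+x. (\<integral>\<^sup>+y. \<rho> (x, y) \<partial>\<nu>) * indicator A x \<partial>\<mu>)"
    proof (intro nn_integral_cong)
      fix x assume x: "x \<in> space \<mu>"
      have "(\<integral>\<^sup>+y. \<rho> (x, y) * indicator (A \<times> space \<nu>) (x, y) \<partial>\<nu>) = (\<integral>\<^sup>+y. \<rho> (x, y) * indicator A x \<partial>\<nu>)"
        by (intro nn_integral_cong) (auto simp: indicator_def)
      then show "(\<integral>\<^sup>+y. \<rho> (x, y) * indicator (A \<times> space \<nu>) (x, y) \<partial>\<nu>) = (\<integral>\<^sup>+y. \<rho> (x, y) \<partial>\<nu>) * indicator A x"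
        using x by (simp add: nn_integral_multc)
    qed
    also have "\<dots> = (\<integral>\<^sup>+x. indicator A x \<partial>\<mu>)"
      using \<rho>1 by (intro nn_integral_cong_AE) auto
    finally show ?thesis by simp
  qed
  have PB: "emeasure P (space \<mu> \<times> B) = emeasure \<nu> B" if B[measurable]: "B \<in> sets \<nu>" for B
  proof -
    have "emeasure P (space \<mu> \<times> B) = (\<integral>\<^sup>+z. \<rho> z * indicator (space \<mu> \<times> B) z \<partial>(\<mu> \<Otimes>\<^sub>M \<nu>))"
      unfolding P_def by (intro emeasure_density) auto
    also have "\<dots> = (\<integral>\<^sup>+y. \<integral>\<^sup>+x. \<rho> (x, y) * indicator (space \<mu> \<times> B) (x, y) \<partial>\<mu> \<partial>\<nu>)"
      by (intro nn_integral_snd[symmetric]) auto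
    also have "\<dots> = (\<integral>\<^sup>+y. (\<integral>\<^sup>+x. \<rho> (x, y) \<partial>\<mu>) * indicator B y \<partial>\<nu>)"
    proof (intro nn_integral_cong)
      fix y assume y: "y \<in> space \<nu>"
      have "(\<integral>\<^sup>+x. \<rho> (x, y) * indicator (space \<mu> \<times> B) (x, y) \<partial>\<mu>) = (\<integral>\<^sup>+x. \<rho> (x, y) * indicator B y \<partial>\<mu>)"
        by (intro nn_integral_cong) (auto simp: indicator_def)
      then show "(\<integral>\<^sup>+x. \<rho> (x, y) * indicator (space \<mu> \<times> B) (x, y) \<partial>\<mu>) = (\<integral>\<^sup>+x. \<rho> (x, y) \<partial>\<mu>) * indicator B y"
        using y by (simp add: nn_integral_multc)
    qed
    also have "\<dots> = (\<integral>\<^sup>+y. indicator B y \<partial>\<nu>)"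
      using \<rho>2 by (intro nn_integral_cong_AE) auto
    finally show ?thesis by simp
  qed
  show thesis
  proof (rule that[of P])
    have "prob_space P"
      using PA[OF sets.top] by (intro prob_spaceI) (simp add: P_def space_pair_measure M.emeasure_space_1)
    then show "P \<in> couplings \<mu> \<nu>"
      using PA PB by (auto simp: couplings_def P_def)
  next
    fix h :: "'a \<times> 'b \<Rightarrow> ennreal" assume [measurable]: "h \<in> borel_measurable (\<mu> \<Otimes>\<^sub>M \<nu>)"
    have "(\<integral>\<^sup>+z. w z * h z \<partial>(\<mu> \<Otimes>\<^sub>M \<nu>)) \<le> (\<integral>\<^sup>+z. \<rho> z * h z \<partial>(\<mu> \<Otimes>\<^sub>M \<nu>))"
      by (intro nn_integral_mono mult_right_mono) (auto simp: \<rho>_def)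
    then show "(\<integral>\<^sup>+z. w z * h z \<partial>(\<mu> \<Otimes>\<^sub>M \<nu>)) \<le> (\<integral>\<^sup>+z. h z \<partial>P)"
      by (simp add: P_def nn_integral_density)
  qed
qed

section \<open>Duality for costs coded by finitely many values\<close>

lemma integral_finite_range:
  fixes F :: "'k \<Rightarrow> real"
  assumes "finite_measure \<nu>" and [measurable]: "\<kappa> \<in> measurable \<nu> (count_space K)" and "finite K"
  shows "(\<integral>y. F (\<kappa> y) \<partial>\<nu>) = (\<Sum>k\<in>K. F k * measure \<nu> (\<kappa> -` {k} \<inter> space \<nu>))"
proof -
  interpret finite_measure \<nu> by fact
  have S[measurable]: "\<kappa> -` {k} \<inter> space \<nu> \<in> sets \<nu>" if "k \<in> K" for k
    using that by (intro measurable_sets[OF assms(2)]) auto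
  have "(\<integral>y. F (\<kappa> y) \<partial>\<nu>) = (\<integral>y. (\<Sum>k\<in>K. F k * indicator (\<kappa> -` {k} \<inter> space \<nu>) y) \<partial>\<nu>)"
  proof (rule Bochner_Integration.integral_cong[OF refl])
    fix y assume y: "y \<in> space \<nu>"
    then have "\<kappa> y \<in> K" using measurable_space[OF assms(2)] by auto
    then show "F (\<kappa> y) = (\<Sum>k\<in>K. F k * indicator (\<kappa> -` {k} \<inter> space \<nu>) y)"
      using y \<open>finite K\<close> by (subst sum.remove[of _ "\<kappa> y"]) (auto simp: indicator_def intro!: sum.neutral)
  qed
  also have "\<dots> = (\<Sum>k\<in>K. F k * measure \<nu> (\<kappa> -` {k} \<inter> space \<nu>))"
    using S by (subst Bochner_Integration.integral_sum) (auto simp: less_top[symmetric])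
  finally show ?thesis .
qed

lemma nn_integral_finite_range:
  fixes F :: "'k \<Rightarrow> real"
  assumes "finite_measure \<nu>" and [measurable]: "\<kappa> \<in> measurable \<nu> (count_space K)" and "finite K"
    and "\<And>k. k \<in> K \<Longrightarrow> 0 \<le> F k"
  shows "(\<integral>\<^sup>+y. ennreal (F (\<kappa> y)) \<partial>\<nu>) = ennreal (\<Sum>k\<in>K. F k * measure \<nu> (\<kappa> -` {k} \<inter> space \<nu>))"
proof -
  interpret finite_measure \<nu> by fact
  have \<kappa>: "\<kappa> y \<in> K" if "y \<in> space \<nu>" for y using that measurable_space[OF assms(2)] by auto
  have [measurable]: "(\<lambda>y. F (\<kappa> y)) \<in> borel_measurable \<nu>"
    by (rule measurable_compose[OF assms(2)]) simp
  have "integrable \<nu> (\<lambda>y. F (\<kappa> y))"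
    using \<kappa> assms(3,4)
    by (intro integrable_const_bound[where B="\<Sum>k\<in>K. F k"]) (auto intro!: AE_I2 member_le_sum)
  then show ?thesis
    using \<kappa> assms(4) integral_finite_range[OF assms(1-3), of F]
    by (subst nn_integral_eq_integral) (auto intro!: AE_I2)
qed

text \<open>Finitely many functions of \<open>x\<close> are glued along the level sets of
  \<open>\<kappa>\<close>. This is the source of all joint measurability, which is not assumed of
  the cost.\<close>

lemma measurable_finite_family:
  assumes "\<And>k. k \<in> K \<Longrightarrow> (\<lambda>x. F x k) \<in> borel_measurable \<mu>"
    and "\<kappa> \<in> measurable \<nu> (count_space K)" and "finite K"
  shows "(\<lambda>z. F (fst z) (\<kappa> (snd z))) \<in> borel_measurable (\<mu> \<Otimes>\<^sub>M \<nu>)"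
proof (rule measurable_compose_countable'[where f="\<lambda>k z. F (fst z) k" and g="\<lambda>z. \<kappa> (snd z)" and I=K])
  show "(\<lambda>z. F (fst z) k) \<in> borel_measurable (\<mu> \<Otimes>\<^sub>M \<nu>)" if "k \<in> K" for k
    by (rule measurable_compose[OF measurable_fst assms(1)[OF that]])
  show "(\<lambda>z. \<kappa> (snd z)) \<in> measurable (\<mu> \<Otimes>\<^sub>M \<nu>) (count_space K)"
    by (rule measurable_compose[OF measurable_snd assms(2)])
qed (simp add: countable_finite \<open>finite K\<close>)

text \<open>The kernel from the penalised problem has only approximately the right second marginal;
  it is rescaled and then completed to a coupling. The multiplier gives the dual pair, which is
  shifted and cut so as to satisfy the bounds that the later limit argument relies on.\<close>

lemma semidiscrete_duality:
  fixes h :: "'a \<Rightarrow> 'k \<Rightarrow> real" and \<kappa> :: "'b \<Rightarrow> 'k"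
  assumes "prob_space \<mu>" "prob_space \<nu>" and K: "finite K" "K \<noteq> {}"
    and \<kappa>[measurable]: "\<kappa> \<in> measurable \<nu> (count_space K)"
    and h_meas[measurable]: "\<And>k. k \<in> K \<Longrightarrow> (\<lambda>x. h x k) \<in> borel_measurable \<mu>"
    and h_bounds: "\<And>x k. 0 \<le> h x k" "\<And>x k. h x k \<le> M"
    and \<epsilon>: "\<epsilon> > 0"
  obtains f g P where "f \<in> borel_measurable \<mu>" "g \<in> borel_measurable \<nu>"
    and "\<And>x. x \<in> space \<mu> \<Longrightarrow> f x \<in> {0..M}" "\<And>y. y \<in> space \<nu> \<Longrightarrow> g y \<in> {0..M}"
    and "\<And>x y. x \<in> space \<mu> \<Longrightarrow> y \<in> space \<nu> \<Longrightarrow> h x (\<kappa> y) \<le> f x + g y"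
    and "P \<in> couplings \<mu> \<nu>"
    and "(\<integral>x. f x \<partial>\<mu>) + (\<integral>y. g y \<partial>\<nu>) \<le> (\<integral>z. h (fst z) (\<kappa> (snd z)) \<partial>P) + \<epsilon>"
proof -
  interpret M: prob_space \<mu> by fact
  interpret N: prob_space \<nu> by fact
  interpret pair_prob_space \<mu> \<nu> ..
  have M: "M \<ge> 0" using h_bounds[of undefined undefined] by linarith
  have \<kappa>K: "\<kappa> y \<in> K" if "y \<in> space \<nu>" for y using that measurable_space[OF \<kappa>] by auto
  define q where "q k = measure \<nu> (\<kappa> -` {k} \<inter> space \<nu>)" for k
  note fin_int = integral_finite_range[OF N.finite_measure_axioms \<kappa> K(1), folded q_def]
  note fin_nn = nn_integral_finite_range[OF N.finite_measure_axioms \<kappa> K(1), folded q_def]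
  have q0: "q k \<ge> 0" for k by (simp add: q_def)
  have q1: "(\<Sum>k\<in>K. q k) = 1" using fin_int[of "\<lambda>_. 1"] by (simp add: N.prob_space)
  define n where "n = real (card K)"
  \<comment> \<open>The budget: the duality gap costs \<open>e\<close>, and rescaling costs at most
    \<open>M * e\<close> for each of the \<open>n\<close> codes.\<close>
  define e where "e = \<epsilon> / (1 + n * M)"
  have nM: "1 + n * M > 0" using M by (simp add: n_def add_pos_nonneg)
  have "(1 + n * M) * e = \<epsilon>" using nM by (simp add: e_def)
  moreover have "(1 + n * M) * e = e + n * M * e" by (simp add: distrib_right)
  ultimately have e: "e > 0" "e + n * M * e = \<epsilon>"
    using nM \<epsilon> by (simp add: e_def, linarith)
  obtain \<phi> f0 g0 where \<phi>m[measurable]: "\<And>k. k \<in> K \<Longrightarrow> (\<lambda>x. \<phi> x k) \<in> borel_measurable \<mu>"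
    and \<phi>0: "\<And>x k. k \<in> K \<Longrightarrow> 0 \<le> \<phi> x k" and \<phi>1: "\<And>x. (\<Sum>k\<in>K. \<phi> x k) = 1"
    and pq: "\<And>k. k \<in> K \<Longrightarrow> \<bar>(\<integral>x. \<phi> x k \<partial>\<mu>) - q k\<bar> \<le> e"
    and f0: "f0 = (\<lambda>x. MAX k\<in>K. h x k - g0 k)"
    and val: "(\<integral>x. f0 x \<partial>\<mu>) + (\<Sum>k\<in>K. g0 k * q k) \<le> (\<Sum>k\<in>K. \<integral>x. h x k * \<phi> x k \<partial>\<mu>) + e"
    by (rule semidiscrete_penalty[where h=h, OF assms(1) K h_meas h_bounds q0 q1 e(1)], assumption) (rule that; simp)
  have \<phi>le: "\<phi> x k \<le> 1" if "k \<in> K" for x k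
    using member_le_sum[of k K "\<phi> x"] that K \<phi>0 \<phi>1[of x] by auto
  define p where "p k = (\<integral>x. \<phi> x k \<partial>\<mu>)" for k
  define v where "v k = (\<integral>x. h x k * \<phi> x k \<partial>\<mu>)" for k
  have \<phi>i: "integrable \<mu> (\<lambda>x. \<phi> x k)" if "k \<in> K" for k
    using that \<phi>0[OF that] \<phi>le[OF that] by (intro M.integrable_const_bound[where B=1]) auto
  have hle: "h x k * \<phi> x k \<le> M * \<phi> x k" if "k \<in> K" for x k
    using h_bounds \<phi>0[OF that] by (intro mult_right_mono) auto
  have hi: "integrable \<mu> (\<lambda>x. h x k * \<phi> x k)" if "k \<in> K" for k
    using that hle[OF that] h_bounds \<phi>0[OF that]
    by (intro Bochner_Integration.integrable_bound[OF integrable_mult_right[OF \<phi>i[OF that], of M]]) 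
       (auto simp: M)
  have p0: "p k \<ge> 0" if "k \<in> K" for k using \<phi>0[OF that] by (simp add: p_def)
  have v: "0 \<le> v k" "v k \<le> M * p k" if "k \<in> K" for k
  proof -
    show "0 \<le> v k" using \<phi>0[OF that] h_bounds by (simp add: v_def)
    have "v k \<le> (\<integral>x. M * \<phi> x k \<partial>\<mu>)" unfolding v_def
      using hi[OF that] \<phi>i[OF that] hle[OF that] by (intro integral_mono) auto
    then show "v k \<le> M * p k" by (simp add: p_def)
  qed
  \<comment> \<open>Dividing by \<open>max (p k) (q k)\<close> instead of \<open>q k\<close> makes both marginals of \<open>w\<close> at most one, at a cost
    controlled by \<open>\<bar>p k - q k\<bar>\<close>.\<close>
  define m where "m k = max (p k) (q k)" for k
  have m: "m k \<ge> 0" "q k / m k \<le> 1" "p k / m k \<le> 1" for k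
    using q0[of k] by (auto simp: m_def max_def divide_le_eq_1)
  define w where "w z = ennreal (\<phi> (fst z) (\<kappa> (snd z)) / m (\<kappa> (snd z)))" for z
  have [measurable]: "w \<in> borel_measurable (\<mu> \<Otimes>\<^sub>M \<nu>)" unfolding w_def
    using measurable_finite_family[where F="\<lambda>x k. \<phi> x k / m k" and \<kappa>=\<kappa> and K=K and \<mu>=\<mu> and \<nu>=\<nu>] K
    by measurable
  have w1: "(\<integral>\<^sup>+y. w (x, y) \<partial>\<nu>) \<le> 1" for x
  proof -
    have "(\<integral>\<^sup>+y. w (x, y) \<partial>\<nu>) = ennreal (\<Sum>k\<in>K. \<phi> x k / m k * q k)"
      unfolding w_def fst_conv snd_conv using \<phi>0 m by (intro fin_nn) auto
    also have "\<dots> \<le> ennreal (\<Sum>k\<in>K. \<phi> x k)"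
    proof (intro ennreal_leI sum_mono)
      fix k assume "k \<in> K"
      then have "\<phi> x k * (q k / m k) \<le> \<phi> x k * 1" using \<phi>0 m by (intro mult_left_mono) auto
      then show "\<phi> x k / m k * q k \<le> \<phi> x k" by simp
    qed
    finally show ?thesis by (simp add: \<phi>1 ennreal_le_1)
  qed
  have w2: "(\<integral>\<^sup>+x. w (x, y) \<partial>\<mu>) \<le> 1" if "y \<in> space \<nu>" for y
  proof -
    have k: "\<kappa> y \<in> K" using \<kappa>K that .
    have "(\<integral>\<^sup>+x. w (x, y) \<partial>\<mu>) = ennreal (\<integral>x. \<phi> x (\<kappa> y) / m (\<kappa> y) \<partial>\<mu>)"
      unfolding w_def fst_conv snd_conv using \<phi>i[OF k] \<phi>0[OF k] m
      by (intro nn_integral_eq_integral) auto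
    also have "\<dots> = ennreal (p (\<kappa> y) / m (\<kappa> y))" by (simp add: p_def)
    finally show ?thesis using m by (simp add: ennreal_le_1)
  qed
  obtain P where P: "P \<in> couplings \<mu> \<nu>"
    and Pw: "\<And>h :: 'a \<times> 'b \<Rightarrow> ennreal. h \<in> borel_measurable (\<mu> \<Otimes>\<^sub>M \<nu>) \<Longrightarrow>
           (\<integral>\<^sup>+z. w z * h z \<partial>(\<mu> \<Otimes>\<^sub>M \<nu>)) \<le> (\<integral>\<^sup>+z. h z \<partial>P)"
    using subcoupling_extends[of \<mu> \<nu> w] assms(1,2) w1 w2 by auto
  interpret Q: prob_space P using P by (simp add: couplings_def)
  have Ps[measurable_cong]: "sets P = sets (\<mu> \<Otimes>\<^sub>M \<nu>)" using P by (simp add: couplings_def)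
  define H where "H z = h (fst z) (\<kappa> (snd z))" for z
  have [measurable]: "H \<in> borel_measurable (\<mu> \<Otimes>\<^sub>M \<nu>)" unfolding H_def
    using K by (intro measurable_finite_family) auto
  have H0: "0 \<le> H z" for z by (simp add: H_def h_bounds)
  have Hi: "integrable P H"
    by (intro Q.integrable_const_bound[where B=M]) (auto simp: H_def h_bounds)
  have "ennreal (\<Sum>k\<in>K. v k * (q k / m k)) = (\<integral>\<^sup>+z. w z * H z \<partial>(\<mu> \<Otimes>\<^sub>M \<nu>))"
  proof -
    have "(\<integral>\<^sup>+z. w z * H z \<partial>(\<mu> \<Otimes>\<^sub>M \<nu>)) = (\<integral>\<^sup>+x. \<integral>\<^sup>+y. w (x, y) * H (x, y) \<partial>\<nu> \<partial>\<mu>)"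
      by (intro N.nn_integral_fst[symmetric]) auto
    also have "\<dots> = (\<integral>\<^sup>+x. ennreal (\<Sum>k\<in>K. h x k * \<phi> x k * (q k / m k)) \<partial>\<mu>)"
    proof (intro nn_integral_cong)
      fix x
      have "(\<integral>\<^sup>+y. w (x, y) * H (x, y) \<partial>\<nu>) = (\<integral>\<^sup>+y. ennreal (h x (\<kappa> y) * \<phi> x (\<kappa> y) / m (\<kappa> y)) \<partial>\<nu>)"
        using \<phi>0[OF \<kappa>K] m h_bounds
        by (intro nn_integral_cong) (simp add: w_def H_def ennreal_mult[symmetric] mult.commute)
      also have "\<dots> = ennreal (\<Sum>k\<in>K. h x k * \<phi> x k / m k * q k)"
        using \<phi>0 m h_bounds by (intro fin_nn[where F="\<lambda>k. h x k * \<phi> x k / m k"]) auto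
      finally show "(\<integral>\<^sup>+y. w (x, y) * H (x, y) \<partial>\<nu>) = ennreal (\<Sum>k\<in>K. h x k * \<phi> x k * (q k / m k))"
        by simp
    qed
    also have "\<dots> = ennreal (\<integral>x. (\<Sum>k\<in>K. h x k * \<phi> x k * (q k / m k)) \<partial>\<mu>)"
      using hi \<phi>0 m q0 h_bounds
      by (intro nn_integral_eq_integral Bochner_Integration.integrable_sum integrable_mult_left) (auto intro!: sum_nonneg AE_I2)
    also have "(\<integral>x. (\<Sum>k\<in>K. h x k * \<phi> x k * (q k / m k)) \<partial>\<mu>) = (\<Sum>k\<in>K. v k * (q k / m k))"
      using hi by (subst Bochner_Integration.integral_sum) (auto simp: v_def simp del: times_divide_eq_right)
    finally show ?thesis by simp
  qed
  also have "\<dots> \<le> (\<integral>\<^sup>+z. H z \<partial>P)" by (intro Pw) auto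
  also have "\<dots> = ennreal (\<integral>z. H z \<partial>P)"
    using Hi H0 by (intro nn_integral_eq_integral) auto
  finally have 1: "(\<Sum>k\<in>K. v k * (q k / m k)) \<le> (\<integral>z. H z \<partial>P)"
    using H0 by (subst (asm) ennreal_le_iff) auto
  \<comment> \<open>The loss at \<open>k\<close> is at most
    \<open>M * p k * (1 - q k / m k)\<close>, where \<open>p k * (1 - q k / m k)\<close> is the
    positive part of \<open>p k - q k\<close>.\<close>
  have "(\<Sum>k\<in>K. v k) \<le> (\<Sum>k\<in>K. v k * (q k / m k) + M * e)"
  proof (intro sum_mono)
    fix k assume k: "k \<in> K"
    have "v k * (1 - q k / m k) \<le> M * p k * (1 - q k / m k)"
      using v(2)[OF k] m(2)[of k] by (intro mult_right_mono) auto
    also have "\<dots> = M * (p k * (1 - q k / m k))" by simp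
    also have "\<dots> \<le> M * e"
    proof (intro mult_left_mono M)
      show "p k * (1 - q k / m k) \<le> e"
      proof (cases "p k \<le> q k")
        case True
        \<comment> \<open>If \<open>q k = 0\<close>, then \<open>p k = 0\<close> as well, so the
          default value of \<open>0 / 0\<close> is multiplied by zero.\<close>
        then show ?thesis using e p0[OF k] by (cases "q k = 0") (auto simp: m_def max_def)
      next
        case False
        then have "p k * (1 - q k / m k) = p k - q k"
          using q0[of k] by (simp add: m_def max_def field_simps)
        then show ?thesis using pq[OF k] by (simp add: p_def)
      qed
    qed
    finally show "v k \<le> v k * (q k / m k) + M * e" by (simp add: algebra_simps)
  qed
  then have 2: "(\<Sum>k\<in>K. v k) \<le> (\<integral>z. H z \<partial>P) + n * M * e"
    using 1 by (simp add: sum.distrib n_def)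
  \<comment> \<open>Moving the constant \<open>b\<close> from \<open>g\<close> to \<open>f\<close> makes both functions nonnegative.\<close>
  define b where "b = (MIN k\<in>K. g0 k)"
  have bmin: "b \<le> g0 k" if "k \<in> K" for k unfolding b_def using K that by auto
  have "b \<in> g0 ` K" unfolding b_def using K by (intro Min_in) auto
  then obtain k0 where k0: "k0 \<in> K" "g0 k0 = b" by auto
  have f0ge: "h x k - g0 k \<le> f0 x" if "k \<in> K" for x k
    using that K by (auto simp: f0 intro!: Max_ge)
  have f0b: "0 \<le> f0 x + b" for x using f0ge[OF k0(1), of x] k0 h_bounds(1)[of x k0] by linarith
  have f0le: "f0 x + b \<le> M" for x
  proof -
    have "f0 x \<le> M - b" unfolding f0 using K h_bounds(2) bmin
      by (subst Max_le_iff) (auto intro: diff_mono)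
    then show ?thesis by simp
  qed
  define f where "f x = f0 x + b" for x
  \<comment> \<open>Cutting at \<open>M\<close> preserves the dual inequality, because
    \<open>f \<ge> 0\<close> and \<open>h \<le> M\<close>, and it only lowers the integral.\<close>
  define g where "g y = min M (g0 (\<kappa> y) - b)" for y
  have [measurable]: "f0 \<in> borel_measurable \<mu>"
    unfolding f0 using K by (intro borel_measurable_Max) auto
  have g0m[measurable]: "(\<lambda>y. g0 (\<kappa> y)) \<in> borel_measurable \<nu>"
    by (rule measurable_compose[OF \<kappa>]) simp
  have [measurable]: "f \<in> borel_measurable \<mu>" unfolding f_def by measurable
  have f0i: "integrable \<mu> f0"
    using f0b f0le by (intro M.integrable_const_bound[where B="M + \<bar>b\<bar>"]) (auto intro!: AE_I2 simp: abs_le_iff, (smt (verit))+)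
  have g0i: "integrable \<nu> (\<lambda>y. g0 (\<kappa> y))"
    using \<kappa>K K by (intro N.integrable_const_bound[where B="\<Sum>k\<in>K. \<bar>g0 k\<bar>"])
      (auto intro!: AE_I2 member_le_sum[where f="\<lambda>k. \<bar>g0 k\<bar>"])
  have gb: "g y \<in> {0..M}" if "y \<in> space \<nu>" for y
    using bmin[OF \<kappa>K[OF that]] M by (auto simp: g_def)
  have [measurable]: "g \<in> borel_measurable \<nu>" unfolding g_def by measurable
  have gi: "integrable \<nu> g"
    using gb by (intro N.integrable_const_bound[where B=M]) (auto intro!: AE_I2)
  have "(\<integral>y. g y \<partial>\<nu>) \<le> (\<integral>y. g0 (\<kappa> y) - b \<partial>\<nu>)"
    using gi g0i by (intro integral_mono) (auto simp: g_def)
  also have "\<dots> = (\<Sum>k\<in>K. g0 k * q k) - b"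
    using g0i fin_int[of g0] by (simp add: N.prob_space)
  finally have "(\<integral>x. f x \<partial>\<mu>) + (\<integral>y. g y \<partial>\<nu>) \<le> (\<integral>x. f0 x \<partial>\<mu>) + (\<Sum>k\<in>K. g0 k * q k)"
    using f0i by (simp add: f_def M.prob_space)
  then have "(\<integral>x. f x \<partial>\<mu>) + (\<integral>y. g y \<partial>\<nu>) \<le> (\<integral>z. H z \<partial>P) + \<epsilon>"
    using val 2 e by (simp add: v_def)
  moreover have "h x (\<kappa> y) \<le> f x + g y" if "y \<in> space \<nu>" for x y
    using f0ge[OF \<kappa>K[OF that], of x] f0b[of x] h_bounds(2)[of x "\<kappa> y"] by (auto simp: f_def g_def min_def)
  ultimately show thesis
    using P gb f0b f0le by (intro that[of f g P]) (auto simp: H_def f_def)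
qed

section \<open>Limits of dual pairs\<close>

text \<open>The sum of the absolute increments has finite integral, hence is finite almost
  everywhere, and there the sequence telescopes.\<close>

lemma AE_convergent_of_summable_L1:
  fixes f :: "nat \<Rightarrow> 'a \<Rightarrow> real"
  assumes [measurable]: "\<And>k. f k \<in> borel_measurable M"
    and le: "\<And>k. (\<integral>\<^sup>+x. ennreal \<bar>f (Suc k) x - f k x\<bar> \<partial>M) \<le> ennreal ((1 / 2) ^ k)"
  shows "AE x in M. convergent (\<lambda>k. f k x)"
proof -
  have "(\<integral>\<^sup>+x. (\<Sum>k. ennreal \<bar>f (Suc k) x - f k x\<bar>) \<partial>M) = (\<Sum>k. \<integral>\<^sup>+x. ennreal \<bar>f (Suc k) x - f k x\<bar> \<partial>M)"
    by (intro nn_integral_suminf) auto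
  also have "\<dots> \<le> (\<Sum>k. ennreal ((1 / 2) ^ k))" using le by (intro suminf_le) auto
  also have "\<dots> = ennreal (\<Sum>k. (1 / 2) ^ k)" by (intro suminf_ennreal2) auto
  finally have "(\<integral>\<^sup>+x. (\<Sum>k. ennreal \<bar>f (Suc k) x - f k x\<bar>) \<partial>M) \<noteq> \<infinity>"
    by (auto simp: top_unique)
  then have "AE x in M. (\<Sum>k. ennreal \<bar>f (Suc k) x - f k x\<bar>) \<noteq> \<infinity>"
    by (intro nn_integral_PInf_AE) auto
  then show ?thesis
  proof (rule AE_mp, intro AE_I2 impI)
    fix x assume "(\<Sum>k. ennreal \<bar>f (Suc k) x - f k x\<bar>) \<noteq> \<infinity>"
    then have "summable (\<lambda>k. \<bar>f (Suc k) x - f k x\<bar>)"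
      by (intro summable_suminf_not_top) (auto simp: infinity_ennreal_def)
    then have "summable (\<lambda>k. f (Suc k) x - f k x)" by (rule summable_rabs_cancel)
    then have "convergent (\<lambda>n. \<Sum>k<n. f (Suc k) x - f k x)" by (simp add: summable_iff_convergent)
    then have "convergent (\<lambda>n. f n x - f 0 x)"
      by (simp add: sum_lessThan_telescope[of "\<lambda>n. f n x"])
    then show "convergent (\<lambda>n. f n x)" using convergent_add_const_right_iff[of "\<lambda>n. f n x" "- f 0 x"] by simp
  qed
qed

text \<open>Beyond the index \<open>r k\<close> the sequence can rise by at most \<open>e k\<close>.
  Applied to minimal energies over decreasing sets, this makes elements chosen at later indices
  nearly minimal for the earlier sets.\<close>

lemma fast_subsequence:
  fixes v :: "nat \<Rightarrow> real"
  assumes "incseq v" "\<And>n. v n \<le> B" "\<And>k. e k > 0"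
  obtains r where "mono r" "\<And>k. k \<le> r k" "\<And>k m. v m \<le> v (r k) + e k"
proof -
  obtain L where L: "v \<longlonglongrightarrow> L" "\<And>i. v i \<le> L"
    using incseq_convergent[of v B] assms by blast
  have "\<exists>n. v n > L - e k" for k
    using order_tendstoD(1)[OF L(1), of "L - e k"] assms(3)[of k] by (auto simp: eventually_sequentially)
  then obtain s where s: "\<And>k. v (s k) > L - e k" by metis
  \<comment> \<open>The partial sum is increasing and dominates \<open>s k\<close>; the added
    \<open>k\<close> gives \<open>k \<le> r k\<close>.\<close>
  define r where "r k = k + (\<Sum>j\<le>k. s j)" for k
  show thesis
  proof (rule that[of r])
    show "mono r" unfolding r_def by (intro monoI add_mono sum_mono2) auto
    show "k \<le> r k" for k by (simp add: r_def)
    show "v m \<le> v (r k) + e k" for k m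
    proof -
      have "s k \<le> (\<Sum>j\<le>k. s j)" by (intro member_le_sum) auto
      then have "v (s k) \<le> v (r k)" using assms(1) by (intro incseqD[OF assms(1)]) (simp add: r_def)
      then show ?thesis using L(2)[of m] s[of k] by linarith
    qed
  qed
qed

text \<open>
  No compactness is available for the dual pairs, but the sets \<open>A n\<close> of admissible pairs are convex and
  decreasing. By the parallelogram law, pairs of nearly minimal \<open>L\<^sup>2\<close> norm form a Cauchy sequence.
\<close>

lemma dual_pairs_limit:
  fixes C :: "nat \<Rightarrow> 'a \<times> 'b \<Rightarrow> real"
  assumes "prob_space \<mu>" "prob_space \<nu>" and M: "M \<ge> 0"
    and C_mono: "\<And>n z. C n z \<le> C (Suc n) z" and C_le: "\<And>n z. C n z \<le> M"
    and ex: "\<And>n. \<exists>f g. f \<in> borel_measurable \<mu> \<and> g \<in> borel_measurable \<nu> \<and>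
      (\<forall>x\<in>space \<mu>. f x \<in> {0..M}) \<and> (\<forall>y\<in>space \<nu>. g y \<in> {0..M}) \<and>
      (\<forall>x\<in>space \<mu>. \<forall>y\<in>space \<nu>. C n (x, y) \<le> f x + g y) \<and> (\<integral>x. f x \<partial>\<mu>) + (\<integral>y. g y \<partial>\<nu>) \<le> B"
  obtains f g where "f \<in> borel_measurable \<mu>" "g \<in> borel_measurable \<nu>"
    and "\<And>x. f x \<in> {0..M}" "\<And>y. g y \<in> {0..M}"
    and "\<And>n x y. x \<in> space \<mu> \<Longrightarrow> y \<in> space \<nu> \<Longrightarrow> C n (x, y) \<le> f x + g y"
    and "(\<integral>x. f x \<partial>\<mu>) + (\<integral>y. g y \<partial>\<nu>) \<le> B"
proof -
  interpret M: prob_space \<mu> by fact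
  interpret N: prob_space \<nu> by fact
  define A where "A n = {(f, g). f \<in> borel_measurable \<mu> \<and> g \<in> borel_measurable \<nu> \<and>
      (\<forall>x\<in>space \<mu>. f x \<in> {0..M}) \<and> (\<forall>y\<in>space \<nu>. g y \<in> {0..M}) \<and>
      (\<forall>x\<in>space \<mu>. \<forall>y\<in>space \<nu>. C n (x, y) \<le> f x + g y) \<and> (\<integral>x. f x \<partial>\<mu>) + (\<integral>y. g y \<partial>\<nu>) \<le> B}" for n
  define E :: "('a \<Rightarrow> real) \<times> ('b \<Rightarrow> real) \<Rightarrow> real"
    where "E u = (\<integral>x. (fst u x)\<^sup>2 \<partial>\<mu>) + (\<integral>y. (snd u y)\<^sup>2 \<partial>\<nu>)" for u
  define v where "v n = (INF u\<in>A n. E u)" for n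
  have A_ne: "A n \<noteq> {}" for n using ex[of n] by (auto simp: A_def)
  have Am: "fst u \<in> borel_measurable \<mu>" "snd u \<in> borel_measurable \<nu>" if "u \<in> A n" for u n
    using that by (auto simp: A_def)
  have Ab: "x \<in> space \<mu> \<Longrightarrow> fst u x \<in> {0..M}" "y \<in> space \<nu> \<Longrightarrow> snd u y \<in> {0..M}" if "u \<in> A n" for u n x y
    using that by (auto simp: A_def)
  have C_incseq: "C m z \<le> C n z" if "m \<le> n" for m n z
    using C_mono that by (rule lift_Suc_mono_le)
  have A_mono: "A n \<subseteq> A m" if "m \<le> n" for m n
    using C_incseq[OF that] unfolding A_def by (fastforce intro: order_trans)
  have int1: "integrable \<mu> (fst u)" and int2: "integrable \<nu> (snd u)" if "u \<in> A n" for u n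
    using Am[OF that] Ab[OF that]
    by (auto intro!: M.integrable_const_bound[where B=M] N.integrable_const_bound[where B=M] AE_I2)
  have sq_le: "(s::real)\<^sup>2 \<le> M\<^sup>2" if "s \<in> {0..M}" for s using that by (auto intro: power_mono)
  have sq1: "integrable \<mu> (\<lambda>x. (fst u x)\<^sup>2)" and sq2: "integrable \<nu> (\<lambda>y. (snd u y)\<^sup>2)" if "u \<in> A n" for u n
    using Am[OF that] Ab[OF that]
    by (auto intro!: M.integrable_const_bound[where B="M\<^sup>2"] N.integrable_const_bound[where B="M\<^sup>2"] AE_I2
        power_mono)
  have E0: "E u \<ge> 0" for u by (simp add: E_def)
  have E_le: "E u \<le> 2 * M\<^sup>2" if "u \<in> A n" for u n
  proof -
    have "(\<integral>x. (fst u x)\<^sup>2 \<partial>\<mu>) \<le> M\<^sup>2"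
      using sq_le[OF Ab(1)[OF that]] by (intro M.integral_le_const sq1[OF that] AE_I2)
    moreover have "(\<integral>y. (snd u y)\<^sup>2 \<partial>\<nu>) \<le> M\<^sup>2"
      using sq_le[OF Ab(2)[OF that]] by (intro N.integral_le_const sq2[OF that] AE_I2)
    ultimately show ?thesis by (simp add: E_def)
  qed
  have bdd: "bdd_below (E ` A n)" for n using E0 by (intro bdd_belowI2)
  have v_le: "v n \<le> E u" if "u \<in> A n" for u n unfolding v_def by (intro cINF_lower bdd that)
  have "incseq v"
    unfolding v_def by (intro incseq_SucI cINF_superset_mono bdd A_ne A_mono) auto
  moreover have "v n \<le> 2 * M\<^sup>2" for n
    using A_ne[of n] v_le E_le by (metis all_not_in_conv order_trans)
  \<comment> \<open>Put \<open>a = (1/4)^k\<close>. Twice the energy errors \<open>a / 8\<close> and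
    \<open>a / 32\<close> plus twice the rise \<open>a / 8\<close> of \<open>v\<close> make
    \<open>9 / 16 * a\<close>, within the bound \<open>a\<close> claimed in \<open>dist\<close>. The
    ratio \<open>1/4\<close> for squared distances becomes \<open>1/2\<close> for mean absolute
    distances.\<close>
  ultimately obtain r where r: "mono r" "\<And>k. k \<le> r k" "\<And>k m. v m \<le> v (r k) + (1/4)^k / 8"
    by (rule fast_subsequence[where e="\<lambda>k. (1/4)^k / 8"]) auto
  have "\<exists>u\<in>A (r k). E u < v (r k) + (1/4)^k / 8" for k
    using cINF_less_iff[OF A_ne bdd, of "r k" "v (r k) + (1/4)^k / 8"] by (simp add: v_def)
  then obtain u where u: "\<And>k. u k \<in> A (r k)" and Eu: "\<And>k. E (u k) < v (r k) + (1/4)^k / 8" by metis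
  define F where "F k = fst (u k)" for k
  define G where "G k = snd (u k)" for k
  have Fm[measurable]: "F k \<in> borel_measurable \<mu>" and Gm[measurable]: "G k \<in> borel_measurable \<nu>" for k
    using Am[OF u] by (auto simp: F_def G_def)
  have Fb: "x \<in> space \<mu> \<Longrightarrow> F k x \<in> {0..M}" and Gb: "y \<in> space \<nu> \<Longrightarrow> G k y \<in> {0..M}" for k x y
    using Ab[OF u] by (auto simp: F_def G_def)
  have Fi: "integrable \<mu> (F k)" and Gi: "integrable \<nu> (G k)" for k
    using int1[OF u] int2[OF u] by (auto simp: F_def G_def)
  have dist: "(\<integral>x. (F (Suc k) x - F k x)\<^sup>2 \<partial>\<mu>) + (\<integral>y. (G (Suc k) y - G k y)\<^sup>2 \<partial>\<nu>) \<le> (1/4)^k" for k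
  proof -
    have uS: "u (Suc k) \<in> A (r k)"
      using u[of "Suc k"] A_mono[OF monoD[OF r(1), of k "Suc k"]] by auto
    \<comment> \<open>Both pairs lie in the convex set \<open>A (r k)\<close>, hence so does their
      midpoint, whose energy is then at least \<open>v (r k)\<close>.\<close>
    define w where "w = ((\<lambda>x. (F k x + F (Suc k) x) / 2), (\<lambda>y. (G k y + G (Suc k) y) / 2))"
    have "w \<in> A (r k)"
    proof -
      have "(\<integral>x. fst w x \<partial>\<mu>) + (\<integral>y. snd w y \<partial>\<nu>) =
          (((\<integral>x. F k x \<partial>\<mu>) + (\<integral>y. G k y \<partial>\<nu>)) + ((\<integral>x. F (Suc k) x \<partial>\<mu>) + (\<integral>y. G (Suc k) y \<partial>\<nu>))) / 2"
        using Fi Gi by (simp add: w_def add_divide_distrib)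
      also have "\<dots> \<le> B"
        using u[of k] uS by (auto simp: A_def F_def G_def)
      finally have "(\<integral>x. fst w x \<partial>\<mu>) + (\<integral>y. snd w y \<partial>\<nu>) \<le> B" .
      moreover have "C (r k) (x, y) \<le> fst w x + snd w y" if "x \<in> space \<mu>" "y \<in> space \<nu>" for x y
      proof -
        have "C (r k) (x, y) \<le> F k x + G k y" "C (r k) (x, y) \<le> F (Suc k) x + G (Suc k) y"
          using u[of k] uS that by (auto simp: A_def F_def G_def)
        then show ?thesis by (simp add: w_def field_simps)
      qed
      moreover have "fst w x \<in> {0..M}" if "x \<in> space \<mu>" for x
        using Fb[OF that, of k] Fb[OF that, of "Suc k"] by (simp add: w_def)
      moreover have "snd w y \<in> {0..M}" if "y \<in> space \<nu>" for y
        using Gb[OF that, of k] Gb[OF that, of "Suc k"] by (simp add: w_def)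
      ultimately show ?thesis by (auto simp: A_def w_def)
    qed
    then have vw: "v (r k) \<le> E w" by (rule v_le)
    have par: "(a - b)\<^sup>2 = 2 * b\<^sup>2 + 2 * a\<^sup>2 - 4 * ((b + a) / 2)\<^sup>2" for a b :: real
      by (simp add: power2_eq_square field_simps)
    note i1 = sq1[OF u[of k]] sq1[OF uS] sq1[OF \<open>w \<in> A (r k)\<close>]
    note i2 = sq2[OF u[of k]] sq2[OF uS] sq2[OF \<open>w \<in> A (r k)\<close>]
    have "(\<integral>x. (F (Suc k) x - F k x)\<^sup>2 \<partial>\<mu>) = 2 * (\<integral>x. (F k x)\<^sup>2 \<partial>\<mu>) + 2 * (\<integral>x. (F (Suc k) x)\<^sup>2 \<partial>\<mu>) - 4 * (\<integral>x. (fst w x)\<^sup>2 \<partial>\<mu>)"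
      using i1 unfolding par[of "F _ _"] by (simp add: F_def w_def)
    moreover have "(\<integral>y. (G (Suc k) y - G k y)\<^sup>2 \<partial>\<nu>) = 2 * (\<integral>y. (G k y)\<^sup>2 \<partial>\<nu>) + 2 * (\<integral>y. (G (Suc k) y)\<^sup>2 \<partial>\<nu>) - 4 * (\<integral>y. (snd w y)\<^sup>2 \<partial>\<nu>)"
      using i2 unfolding par[of "G _ _"] by (simp add: G_def w_def)
    ultimately have "(\<integral>x. (F (Suc k) x - F k x)\<^sup>2 \<partial>\<mu>) + (\<integral>y. (G (Suc k) y - G k y)\<^sup>2 \<partial>\<nu>)
        = 2 * E (u k) + 2 * E (u (Suc k)) - 4 * E w"
      by (simp add: E_def F_def G_def)
    also have "\<dots> \<le> (1/4)^k"
    proof -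
      have pS: "(1/4::real) ^ Suc k = (1/4)^k / 4" by simp
      have "(0::real) \<le> (1/4)^k" by simp
      then show ?thesis
        using Eu[of k] Eu[of "Suc k", unfolded pS] r(3)[of "r (Suc k)" k] vw by linarith
    qed
    finally show ?thesis .
  qed
  have L1: "(\<integral>\<^sup>+x. ennreal \<bar>H (Suc k) x - H k x\<bar> \<partial>R) \<le> ennreal ((1/2)^k)"
    if "prob_space R" and [measurable]: "\<And>k. H k \<in> borel_measurable R"
      and Hb: "\<And>k x. x \<in> space R \<Longrightarrow> H k x \<in> {0..M}"
      and H2: "(\<integral>x. (H (Suc k) x - H k x)\<^sup>2 \<partial>R) \<le> (1/4)^k"
    for R :: "'c measure" and H :: "nat \<Rightarrow> 'c \<Rightarrow> real" and k
  proof -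
    interpret R: prob_space R by fact
    have d: "\<bar>H (Suc k) x - H k x\<bar> \<le> M" if "x \<in> space R" for x
      using Hb[OF that, of k] Hb[OF that, of "Suc k"] by auto
    have d2: "(H (Suc k) x - H k x)\<^sup>2 \<le> M\<^sup>2" if "x \<in> space R" for x
      using d[OF that] M by (simp add: abs_le_square_iff[symmetric])
    have i1: "integrable R (\<lambda>x. \<bar>H (Suc k) x - H k x\<bar>)"
      using d by (intro R.integrable_const_bound[where B=M]) (auto intro!: AE_I2)
    have i2: "integrable R (\<lambda>x. (H (Suc k) x - H k x)\<^sup>2)"
      using d2 by (intro R.integrable_const_bound[where B="M\<^sup>2"]) (auto intro!: AE_I2)
    \<comment> \<open>AM-GM replaces the Cauchy-Schwarz inequality.\<close>
    have amgm: "\<bar>s\<bar> \<le> ((1/2)^k + 2^k * s\<^sup>2) / 2" for s :: real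
    proof -
      have "0 \<le> (1 - 2^k * \<bar>s\<bar>)\<^sup>2" by simp
      then have "2 * (2^k * \<bar>s\<bar>) \<le> 1 + 2^k * (2^k * s\<^sup>2)"
        by (simp add: power2_eq_square algebra_simps)
      then have "2^k * (2 * \<bar>s\<bar>) \<le> 2^k * ((1/2)^k + 2^k * s\<^sup>2)"
        by (simp add: distrib_left power_divide)
      then show ?thesis by simp
    qed
    have "(\<integral>x. \<bar>H (Suc k) x - H k x\<bar> \<partial>R) \<le> (\<integral>x. ((1/2)^k + 2^k * (H (Suc k) x - H k x)\<^sup>2) / 2 \<partial>R)"
      using i1 i2 amgm by (intro integral_mono) auto
    also have "\<dots> = ((1/2)^k + 2^k * (\<integral>x. (H (Suc k) x - H k x)\<^sup>2 \<partial>R)) / 2"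
      using i2 by (simp add: R.prob_space)
    also have "\<dots> \<le> ((1/2)^k + 2^k * (1/4)^k) / 2"
      using H2 by (intro divide_right_mono add_left_mono mult_left_mono) auto
    also have "\<dots> = (1/2)^k" by (simp add: power_mult_distrib[symmetric])
    finally have "(\<integral>x. \<bar>H (Suc k) x - H k x\<bar> \<partial>R) \<le> (1/2)^k" .
    then show ?thesis using i1 by (subst nn_integral_eq_integral) (auto intro: ennreal_leI)
  qed
  have aeF: "AE x in \<mu>. convergent (\<lambda>k. F k x)"
  proof (rule AE_convergent_of_summable_L1)
    fix k
    have "0 \<le> (\<integral>y. (G (Suc k) y - G k y)\<^sup>2 \<partial>\<nu>)" by simp
    then have "(\<integral>x. (F (Suc k) x - F k x)\<^sup>2 \<partial>\<mu>) \<le> (1/4)^k"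
      using dist[of k] by linarith
    then show "(\<integral>\<^sup>+x. ennreal \<bar>F (Suc k) x - F k x\<bar> \<partial>\<mu>) \<le> ennreal ((1/2)^k)"
      using Fb by (intro L1 assms(1)) auto
  qed simp
  have aeG: "AE y in \<nu>. convergent (\<lambda>k. G k y)"
  proof (rule AE_convergent_of_summable_L1)
    fix k
    have "0 \<le> (\<integral>x. (F (Suc k) x - F k x)\<^sup>2 \<partial>\<mu>)" by simp
    then have "(\<integral>y. (G (Suc k) y - G k y)\<^sup>2 \<partial>\<nu>) \<le> (1/4)^k"
      using dist[of k] by linarith
    then show "(\<integral>\<^sup>+y. ennreal \<bar>G (Suc k) y - G k y\<bar> \<partial>\<nu>) \<le> ennreal ((1/2)^k)"
      using Gb by (intro L1 assms(2)) auto
  qed simp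
  \<comment> \<open>\<open>F k\<close> is controlled only on \<open>space \<mu>\<close>; testing for
    membership makes the bounds of \<open>f\<close> hold for all arguments.\<close>
  define f where "f x = (if x \<in> space \<mu> \<and> convergent (\<lambda>k. F k x) then lim (\<lambda>k. F k x) else M)" for x
  define g where "g y = (if y \<in> space \<nu> \<and> convergent (\<lambda>k. G k y) then lim (\<lambda>k. G k y) else M)" for y
  have [measurable]: "f \<in> borel_measurable \<mu>" "g \<in> borel_measurable \<nu>"
    unfolding f_def g_def Cauchy_convergent_iff[symmetric] by measurable
  have lim_b: "lim s \<in> {0..M}" if "convergent s" "\<And>k. s k \<in> {0..M}" for s :: "nat \<Rightarrow> real"
    using that closed_sequentially[of "{0..M}" s "lim s"] by (auto simp: convergent_LIMSEQ_iff)
  have fb: "f x \<in> {0..M}" for x using lim_b[of "\<lambda>k. F k x"] Fb M by (auto simp: f_def)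
  have gb: "g y \<in> {0..M}" for y using lim_b[of "\<lambda>k. G k y"] Gb M by (auto simp: g_def)
  have "(\<lambda>k. \<integral>x. F k x \<partial>\<mu>) \<longlonglongrightarrow> (\<integral>x. f x \<partial>\<mu>)"
  proof (rule integral_dominated_convergence[where w="\<lambda>_. M"])
    show "AE x in \<mu>. (\<lambda>k. F k x) \<longlonglongrightarrow> f x"
      using aeF by (rule AE_mp) (auto simp: f_def convergent_LIMSEQ_iff)
    show "AE x in \<mu>. norm (F k x) \<le> M" for k using Fb by (auto intro!: AE_I2)
  qed auto
  moreover have "(\<lambda>k. \<integral>y. G k y \<partial>\<nu>) \<longlonglongrightarrow> (\<integral>y. g y \<partial>\<nu>)"
  proof (rule integral_dominated_convergence[where w="\<lambda>_. M"])
    show "AE y in \<nu>. (\<lambda>k. G k y) \<longlonglongrightarrow> g y"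
      using aeG by (rule AE_mp) (auto simp: g_def convergent_LIMSEQ_iff)
    show "AE y in \<nu>. norm (G k y) \<le> M" for k using Gb by (auto intro!: AE_I2)
  qed auto
  ultimately have "(\<lambda>k. (\<integral>x. F k x \<partial>\<mu>) + (\<integral>y. G k y \<partial>\<nu>)) \<longlonglongrightarrow> (\<integral>x. f x \<partial>\<mu>) + (\<integral>y. g y \<partial>\<nu>)"
    by (rule tendsto_add)
  then have val: "(\<integral>x. f x \<partial>\<mu>) + (\<integral>y. g y \<partial>\<nu>) \<le> B"
    using u by (intro LIMSEQ_le_const2) (auto simp: A_def F_def G_def case_prod_beta)
  have dom: "C n (x, y) \<le> f x + g y" if x: "x \<in> space \<mu>" and y: "y \<in> space \<nu>" for n x y
  proof (cases "convergent (\<lambda>k. F k x) \<and> convergent (\<lambda>k. G k y)")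
    case True
    then have "(\<lambda>k. F k x + G k y) \<longlonglongrightarrow> f x + g y"
      using x y by (intro tendsto_add) (auto simp: f_def g_def convergent_LIMSEQ_iff)
    moreover have "C n (x, y) \<le> F k x + G k y" if "n \<le> k" for k
      using u[of k] x y C_incseq[of n "r k" "(x, y)"] r(2)[of k] that
      by (force simp: A_def F_def G_def case_prod_beta intro: order_trans)
    ultimately show ?thesis by (intro LIMSEQ_le_const) auto
  next
    case False
    \<comment> \<open>One of the two functions equals \<open>M\<close> here, the other is
      nonnegative, and \<open>C n \<le> M\<close>, so no point has to be excluded.\<close>
    then show ?thesis using C_le[of n "(x, y)"] fb[of x] gb[of y] by (auto simp: f_def g_def)
  qed
  show thesis using fb gb dom val by (intro that[of f g]) auto
qed

section \<open>Approximation of Caratheodory costs\<close>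

text \<open>By continuity, on the closure \<open>c (x, y)\<close> is the supremum of its infima over
  small balls containing \<open>y\<close>. Listing the balls in a fixed order makes the codes grow
  with \<open>n\<close>, so the approximations increase, and no modulus of continuity uniform in
  \<open>x\<close> is involved. The infima see only the sequence, hence carry no information on
  \<open>c\<close> off its closure.\<close>

lemma semidiscrete_approximation:
  fixes c :: "'a \<times> 'b::metric_space \<Rightarrow> real" and s :: "nat \<Rightarrow> 'b"
  assumes \<nu>: "sets \<nu> = sets borel"
    and c_meas: "\<And>y. (\<lambda>x. c (x, y)) \<in> borel_measurable \<mu>"
    and c_cont: "\<And>x. continuous_on UNIV (\<lambda>y. c (x, y))"
    and c_bounds: "\<And>z. 0 \<le> c z" "\<And>z. c z \<le> M"
  obtains h :: "'a \<Rightarrow> nat set \<Rightarrow> real" and \<kappa> :: "nat \<Rightarrow> 'b \<Rightarrow> nat set"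
  where "\<And>n. \<kappa> n \<in> measurable \<nu> (count_space (Pow {..<n}))"
    and "\<And>k. (\<lambda>x. h x k) \<in> borel_measurable \<mu>"
    and "\<And>x k. 0 \<le> h x k" "\<And>x k. h x k \<le> M"
    and "\<And>n x y. h x (\<kappa> n y) \<le> h x (\<kappa> (Suc n) y)"
    and "\<And>n x y. y \<in> closure (range s) \<Longrightarrow> h x (\<kappa> n y) \<le> c (x, y)"
    and "\<And>x y. y \<in> closure (range s) \<Longrightarrow> (\<lambda>n. h x (\<kappa> n y)) \<longlonglongrightarrow> c (x, y)"
proof -
  \<comment> \<open>The code \<open>\<kappa> n y\<close> lists those of the first \<open>n\<close> balls that contain \<open>y\<close>; on a ball, \<open>c (x, _)\<close> is replaced by
    its infimum over the dense sequence, which is measurable in \<open>x\<close>.\<close>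
  define U where "U i = ball (s (fst (prod_decode i))) (1 / Suc (snd (prod_decode i)))" for i
  define J where "J i = {j. s j \<in> U i}" for i
  define I where "I x i = (INF j\<in>J i. c (x, s j))" for x i
  \<comment> \<open>The guard and the inserted 0 make the bounds valid for every set
    \<open>k\<close>, including infinite sets and the empty code.\<close>
  define h where "h x k = (if finite k then Max (insert 0 (I x ` k)) else 0)" for x k
  define \<kappa> where "\<kappa> n y = {i. i < n \<and> y \<in> U i}" for n :: nat and y
  have M: "0 \<le> M" using c_bounds order_trans by blast
  have space_\<nu>: "space \<nu> = UNIV" using sets_eq_imp_space_eq[OF \<nu>] by simp
  have U_open: "open (U i)" for i by (simp add: U_def)
  have U_sets[measurable]: "U i \<in> sets \<nu>" for i using U_open \<nu> by auto
  have J_ne: "fst (prod_decode i) \<in> J i" for i by (simp add: J_def U_def)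
  have bdd: "bdd_below ((\<lambda>j. c (x, s j)) ` J i)" for x i
    using c_bounds by (intro bdd_belowI2)
  have I0: "0 \<le> I x i" for x i
    unfolding I_def using J_ne[of i] c_bounds by (intro cINF_greatest) auto
  have I_le: "I x i \<le> c (x, s j)" if "s j \<in> U i" for x i j
    unfolding I_def using that by (intro cINF_lower bdd) (simp add: J_def)
  have IM: "I x i \<le> M" for x i
    using I_le[of "fst (prod_decode i)" i x] J_ne[of i] c_bounds(2) by (force simp: J_def intro: order_trans)
  have Im[measurable]: "(\<lambda>x. I x i) \<in> borel_measurable \<mu>" for i
    unfolding I_def using c_meas by (intro borel_measurable_cINF_real) auto
  have hm: "(\<lambda>x. h x k) \<in> borel_measurable \<mu>" for k
  proof (cases "finite k")
    case True
    \<comment> \<open>\<open>None\<close> indexes the constant 0, so that \<open>h\<close> becomes a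
      single maximum over a finite nonempty family of measurable functions.\<close>
    have "(\<lambda>x. MAX i\<in>insert None (Some ` k). case i of None \<Rightarrow> 0 | Some i \<Rightarrow> I x i) \<in> borel_measurable \<mu>"
      using True by (intro borel_measurable_Max) (auto split: option.splits)
    moreover have "h x k = (MAX i\<in>insert None (Some ` k). case i of None \<Rightarrow> 0 | Some i \<Rightarrow> I x i)" for x
      using True by (simp add: h_def image_image)
    ultimately show ?thesis by simp
  qed (simp add: h_def)
  have h0: "0 \<le> h x k" for x k by (auto simp: h_def)
  have h_le: "h x k \<le> r" if "0 \<le> r" "\<And>i. i \<in> k \<Longrightarrow> I x i \<le> r" for x k r
    using that by (auto simp: h_def)
  have h_ge: "I x i \<le> h x k" if "finite k" "i \<in> k" for x k i
    using that by (auto simp: h_def)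
  have \<kappa>_fin: "finite (\<kappa> n y)" for n y by (simp add: \<kappa>_def)
  have \<kappa>m: "\<kappa> n \<in> measurable \<nu> (count_space (Pow {..<n}))" for n
  proof (subst measurable_count_space_eq2, simp, intro conjI ballI)
    show "\<kappa> n \<in> space \<nu> \<rightarrow> Pow {..<n}" by (auto simp: \<kappa>_def)
    fix k :: "nat set" assume "k \<in> Pow {..<n}"
    then have "\<kappa> n y = k \<longleftrightarrow> (\<forall>i\<in>{..<n}. y \<in> U i \<longleftrightarrow> i \<in> k)" for y
      unfolding \<kappa>_def by blast
    then have "\<kappa> n -` {k} \<inter> space \<nu> = {y \<in> space \<nu>. \<forall>i\<in>{..<n}. y \<in> U i \<longleftrightarrow> i \<in> k}"
      by blast
    also have "\<dots> \<in> sets \<nu>"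
    proof (rule sets.sets_Collect_finite_All)
      show "{y \<in> space \<nu>. y \<in> U i \<longleftrightarrow> i \<in> k} \<in> sets \<nu>" for i
      proof (cases "i \<in> k")
        case True
        then have "{y \<in> space \<nu>. y \<in> U i \<longleftrightarrow> i \<in> k} = space \<nu> \<inter> U i" by (auto simp: space_\<nu>)
        then show ?thesis by (simp only: sets.Int sets.top U_sets)
      next
        case False
        then have "{y \<in> space \<nu>. y \<in> U i \<longleftrightarrow> i \<in> k} = space \<nu> - U i" by (auto simp: space_\<nu>)
        then show ?thesis by (simp only: sets.Diff sets.top U_sets)
      qed
    qed simp
    finally show "\<kappa> n -` {k} \<inter> space \<nu> \<in> sets \<nu>" .
  qed
  have cont: "\<exists>\<delta>>0. \<forall>y'. dist y' y < \<delta> \<longrightarrow> \<bar>c (x, y') - c (x, y)\<bar> < e" if "e > 0" for x y e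
    using c_cont[of x] that by (auto simp: continuous_on_iff dist_real_def)
  have I_le_c: "I x i \<le> c (x, y)" if y: "y \<in> closure (range s)" "y \<in> U i" for x y i
  proof (rule field_le_epsilon)
    fix e :: real assume "e > 0"
    then obtain \<delta> where \<delta>: "\<delta> > 0" "\<And>y'. dist y' y < \<delta> \<Longrightarrow> \<bar>c (x, y') - c (x, y)\<bar> < e"
      using cont by meson
    have "open (U i \<inter> ball y \<delta>)" "y \<in> U i \<inter> ball y \<delta>" using U_open y \<delta>(1) by auto
    \<comment> \<open>\<open>y\<close> need not be a term of the sequence, but terms lying in
      \<open>U i\<close> come arbitrarily close to it.\<close>
    then have "U i \<inter> ball y \<delta> \<inter> range s \<noteq> {}"
      using y(1) open_Int_closure_eq_empty[of "U i \<inter> ball y \<delta>" "range s"] by blast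
    then obtain j where "s j \<in> U i \<inter> ball y \<delta>" by blast
    then show "I x i \<le> c (x, y) + e"
      using I_le[of j i x] \<delta>(2)[of "s j"] by (auto simp: dist_commute abs_less_iff)
  qed
  have le: "h x (\<kappa> n y) \<le> c (x, y)" if "y \<in> closure (range s)" for x y n
    using that c_bounds I_le_c by (intro h_le) (auto simp: \<kappa>_def)
  have lim: "(\<lambda>n. h x (\<kappa> n y)) \<longlonglongrightarrow> c (x, y)" if y: "y \<in> closure (range s)" for x y
  proof (rule LIMSEQ_I)
    fix e :: real assume "e > 0"
    then obtain \<delta> where \<delta>: "\<delta> > 0" "\<And>y'. dist y' y < \<delta> \<Longrightarrow> \<bar>c (x, y') - c (x, y)\<bar> < e / 2"
      using cont[of "e / 2"] by (meson half_gt_zero)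
    \<comment> \<open>Two points of a ball of radius \<open>1 / Suc m\<close> are then less than
      \<open>\<delta>\<close> apart, so every term of the sequence in such a ball around
      \<open>y\<close> has cost within \<open>e / 2\<close> of \<open>c (x, y)\<close>.\<close>
    obtain m where m: "1 / real (Suc m) < \<delta> / 2"
      using \<delta>(1) by (metis half_gt_zero nat_approx_posE)
    obtain j where j: "dist (s j) y < 1 / real (Suc m)"
      using y unfolding closure_approachable by (auto dest!: spec[of _ "1 / real (Suc m)"])
    define i where "i = prod_encode (j, m)"
    have yU: "y \<in> U i" using j by (simp add: U_def i_def)
    have I_near: "c (x, y) - e / 2 \<le> I x i"
      unfolding I_def
    proof (rule cINF_greatest)
      show "J i \<noteq> {}" using J_ne[of i] by auto
      fix j' assume "j' \<in> J i"
      then have "dist (s j) (s j') < 1 / real (Suc m)" by (simp add: J_def U_def i_def)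
      then have "dist (s j') y < \<delta>" using j m dist_triangle[of "s j'" y "s j"] by (simp add: dist_commute)
      then show "c (x, y) - e / 2 \<le> c (x, s j')" using \<delta>(2)[of "s j'"] by linarith
    qed
    have "norm (h x (\<kappa> n y) - c (x, y)) < e" if "n \<ge> Suc i" for n
    proof -
      have "I x i \<le> h x (\<kappa> n y)"
        using that yU by (intro h_ge \<kappa>_fin) (simp add: \<kappa>_def)
      then show ?thesis
        using I_near le[OF y, of x n] \<open>e > 0\<close> unfolding real_norm_def by linarith
    qed
    then show "\<exists>no. \<forall>n\<ge>no. norm (h x (\<kappa> n y) - c (x, y)) < e" by blast
  qed
  show thesis
  proof (rule that[of \<kappa> h])
    show "h x (\<kappa> n y) \<le> h x (\<kappa> (Suc n) y)" for n x y
      using h0 h_ge[OF \<kappa>_fin] by (intro h_le) (auto simp: \<kappa>_def)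
    show "h x k \<le> M" for x k using M IM by (intro h_le)
  qed (use \<kappa>m hm h0 le lim in auto)
qed

section \<open>Integration over couplings\<close>

lemma coupling_distr:
  assumes "P \<in> couplings \<mu> \<nu>"
  shows "distr P \<mu> fst = \<mu>" and "distr P \<nu> snd = \<nu>"
proof -
  have sP[measurable_cong]: "sets P = sets (\<mu> \<Otimes>\<^sub>M \<nu>)" using assms by (simp add: couplings_def)
  have sp: "space P = space \<mu> \<times> space \<nu>" using sets_eq_imp_space_eq[OF sP] by (simp add: space_pair_measure)
  show "distr P \<mu> fst = \<mu>"
  proof (rule measure_eqI)
    fix A assume "A \<in> sets (distr P \<mu> fst)"
    then have A: "A \<in> sets \<mu>" by simp
    then have "fst -` A \<inter> space P = A \<times> space \<nu>"
      using sets.sets_into_space[OF A] by (auto simp: sp)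
    then show "emeasure (distr P \<mu> fst) A = emeasure \<mu> A"
      using assms A by (simp add: emeasure_distr couplings_def)
  qed simp
  show "distr P \<nu> snd = \<nu>"
  proof (rule measure_eqI)
    fix B assume "B \<in> sets (distr P \<nu> snd)"
    then have B: "B \<in> sets \<nu>" by simp
    then have "snd -` B \<inter> space P = space \<mu> \<times> B"
      using sets.sets_into_space[OF B] by (auto simp: sp)
    then show "emeasure (distr P \<nu> snd) B = emeasure \<nu> B"
      using assms B by (simp add: emeasure_distr couplings_def)
  qed simp
qed

lemma coupling_integral_sum:
  fixes f :: "'a \<Rightarrow> real" and g :: "'b \<Rightarrow> real"
  assumes P: "P \<in> couplings \<mu> \<nu>" and "integrable \<mu> f" "integrable \<nu> g"
  shows "integrable P (\<lambda>z. f (fst z) + g (snd z))"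
    and "(\<integral>z. f (fst z) + g (snd z) \<partial>P) = (\<integral>x. f x \<partial>\<mu>) + (\<integral>y. g y \<partial>\<nu>)"
proof -
  have [measurable_cong]: "sets P = sets (\<mu> \<Otimes>\<^sub>M \<nu>)" using P by (simp add: couplings_def)
  have i: "integrable P (\<lambda>z. f (fst z))" "integrable P (\<lambda>z. g (snd z))"
    using integrable_distr[of fst P \<mu> f] integrable_distr[of snd P \<nu> g] assms coupling_distr[OF P] by auto
  have "(\<integral>z. f (fst z) \<partial>P) = (\<integral>x. f x \<partial>\<mu>)" "(\<integral>z. g (snd z) \<partial>P) = (\<integral>y. g y \<partial>\<nu>)"
    using integral_distr[of fst P \<mu> f] integral_distr[of snd P \<nu> g] assms coupling_distr[OF P] by auto
  then show "integrable P (\<lambda>z. f (fst z) + g (snd z))"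
    and "(\<integral>z. f (fst z) + g (snd z) \<partial>P) = (\<integral>x. f x \<partial>\<mu>) + (\<integral>y. g y \<partial>\<nu>)"
    using i by simp_all
qed

text \<open>The two functions differ inside a null set, and every subset of a null set is measurable
  for the completion.\<close>

lemma borel_measurable_completion_AE:
  assumes f: "f \<in> borel_measurable M" and eq: "AE x in M. f x = g x"
  shows "g \<in> borel_measurable (completion M)"
proof (rule measurableI)
  fix A :: "'b set" assume A: "A \<in> sets borel"
  have [measurable]: "Measurable.pred (completion M) (\<lambda>x. f x \<noteq> g x)"
    using eq by (intro sets_completion_AE) auto
  have [measurable]: "Measurable.pred (completion M) (\<lambda>x. f x \<noteq> g x \<and> g x \<in> A)"
    using eq by (intro sets_completion_AE) auto
  have [measurable]: "f \<in> borel_measurable (completion M)" "A \<in> sets borel"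
    using f A by (auto intro: measurable_completion)
  have "g -` A \<inter> space (completion M) =
      {x \<in> space (completion M). (\<not> f x \<noteq> g x \<and> f x \<in> A) \<or> (f x \<noteq> g x \<and> g x \<in> A)}" by auto
  also have "\<dots> \<in> sets (completion M)" by measurable
  finally show "g -` A \<inter> space (completion M) \<in> sets (completion M)" .
qed simp

lemma coupling_AE_snd:
  assumes P: "P \<in> couplings \<mu> \<nu>" and "prob_space \<nu>" and S: "S \<in> sets \<nu>" "emeasure \<nu> S = 1"
  shows "AE z in P. snd z \<in> S"
proof -
  interpret N: prob_space \<nu> by fact
  have [measurable_cong]: "sets P = sets (\<mu> \<Otimes>\<^sub>M \<nu>)" using P by (simp add: couplings_def)
  have "AE y in \<nu>. y \<in> S"
    using S by (simp add: N.emeasure_eq_measure N.AE_in_set_eq_1)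
  then have "AE y in distr P \<nu> snd. y \<in> S" by (simp only: coupling_distr[OF P])
  then show ?thesis using S by (subst (asm) AE_distr_iff) auto
qed

text \<open>This trades the completed integral of \<open>c\<close> for an ordinary one. A set of
  full \<open>\<nu>\<close>-measure has full mass under every coupling, so a single
  \<open>c'\<close> serves them all.\<close>

lemma coupling_completion:
  fixes c c' :: "'a \<times> 'b \<Rightarrow> real"
  assumes P: "P \<in> couplings \<mu> \<nu>" and c': "c' \<in> borel_measurable (\<mu> \<Otimes>\<^sub>M \<nu>)"
    and AE: "AE z in P. snd z \<in> S"
    and eq: "\<And>x y. y \<in> S \<Longrightarrow> c (x, y) = c' (x, y)"
  shows "(\<integral>z. c z \<partial>completion P) = (\<integral>z. c' z \<partial>P)"
proof -
  have [measurable_cong]: "sets P = sets (\<mu> \<Otimes>\<^sub>M \<nu>)" using P by (simp add: couplings_def)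
  have c'P: "c' \<in> borel_measurable P" using c' by measurable
  have ae: "AE z in P. c' z = c z" using AE by (rule AE_mp) (auto simp: eq)
  have m: "c \<in> borel_measurable (completion P)"
    by (rule borel_measurable_completion_AE[OF c'P ae])
  have "(\<integral>z. c z \<partial>completion P) = (\<integral>z. c' z \<partial>completion P)"
    using AE_completion[OF ae] m c'P by (intro integral_cong_AE) (auto intro: measurable_completion)
  then show "(\<integral>z. c z \<partial>completion P) = (\<integral>z. c' z \<partial>P)"
    using c'P by (simp add: integral_completion)
qed

section \<open>Duality\<close>

text \<open>Limits of the coded approximations are jointly measurable. Those approximations require
  a bounded cost, hence the cuts at level \<open>k\<close>; at each point the cuts are eventually
  constant, and a second limit recovers \<open>c - b\<close>.\<close>

lemma product_measurable_version:
  fixes c :: "'a \<times> 'b::metric_space \<Rightarrow> real" and s :: "nat \<Rightarrow> 'b"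
  assumes \<nu>: "sets \<nu> = sets borel"
    and c_meas: "\<And>y. (\<lambda>x. c (x, y)) \<in> borel_measurable \<mu>"
    and c_cont: "\<And>x. continuous_on UNIV (\<lambda>y. c (x, y))"
    and c_ge: "\<And>z. b \<le> c z"
  obtains c' where "c' \<in> borel_measurable (\<mu> \<Otimes>\<^sub>M \<nu>)"
    and "\<And>x y. y \<in> closure (range s) \<Longrightarrow> c (x, y) = c' (x, y)"
proof -
  have "\<exists>t'. t' \<in> borel_measurable (\<mu> \<Otimes>\<^sub>M \<nu>) \<and>
      (\<forall>x. \<forall>y\<in>closure (range s). min (c (x, y) - b) (real k) = t' (x, y))" for k
  proof -
    have 1: "(\<lambda>x. min (c (x, y) - b) (real k)) \<in> borel_measurable \<mu>" for y
      using c_meas by measurable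
    have 2: "continuous_on UNIV (\<lambda>y. min (c (x, y) - b) (real k))" for x
      using c_cont by (intro continuous_intros)
    obtain h :: "'a \<Rightarrow> nat set \<Rightarrow> real" and \<kappa> where
      \<kappa>: "\<And>n. \<kappa> n \<in> measurable \<nu> (count_space (Pow {..<n}))"
      and h: "\<And>k. (\<lambda>x. h x k) \<in> borel_measurable \<mu>"
      and lim: "\<And>x y. y \<in> closure (range s) \<Longrightarrow> (\<lambda>n. h x (\<kappa> n y)) \<longlonglongrightarrow> min (c (x, y) - b) (real k)"
      by (rule semidiscrete_approximation[where \<nu>=\<nu> and \<mu>=\<mu> and s=s and M="real k"
            and c="\<lambda>z. min (c z - b) (real k)"]) (use \<nu> 1 2 c_ge in auto)
    define t' where "t' z = lim (\<lambda>n. h (fst z) (\<kappa> n (snd z)))" for z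
    have "t' \<in> borel_measurable (\<mu> \<Otimes>\<^sub>M \<nu>)"
      unfolding t'_def using h \<kappa>
      by (intro borel_measurable_lim_metric measurable_finite_family) auto
    moreover have "min (c (x, y) - b) (real k) = t' (x, y)" if "y \<in> closure (range s)" for x y
      using limI[OF lim[OF that]] by (simp add: t'_def)
    ultimately show ?thesis by blast
  qed
  then obtain t' where t'[measurable]: "\<And>k. t' k \<in> borel_measurable (\<mu> \<Otimes>\<^sub>M \<nu>)"
    and t'_eq: "\<And>k x y. y \<in> closure (range s) \<Longrightarrow> min (c (x, y) - b) (real k) = t' k (x, y)"
    by metis
  define c' where "c' z = b + lim (\<lambda>k. t' k z)" for z
  have "c (x, y) = c' (x, y)" if "y \<in> closure (range s)" for x y
  proof -
    obtain k0 :: nat where "c (x, y) - b \<le> real k0" using real_arch_simple by blast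
    then have "eventually (\<lambda>k. t' k (x, y) = c (x, y) - b) sequentially"
      by (intro eventually_sequentiallyI[of k0]) (simp add: t'_eq[OF that, symmetric])
    then have "(\<lambda>k. t' k (x, y)) \<longlonglongrightarrow> c (x, y) - b" by (rule tendsto_eventually)
    then show ?thesis by (simp add: c'_def limI)
  qed
  moreover have "c' \<in> borel_measurable (\<mu> \<Otimes>\<^sub>M \<nu>)" unfolding c'_def by measurable
  ultimately show thesis by (rule that[rotated])
qed

text \<open>\<open>B\<close> stands for the primal supremum. Each approximating cost has a nearly
  optimal coupling, on which its integral is at most that of \<open>c\<close>; hence its dual pair
  has value at most \<open>B + \<epsilon>\<close> with the same \<open>\<epsilon>\<close> for all
  \<open>n\<close>, as the passage to the limit requires.\<close>

lemma bounded_dual_pair: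
  fixes c :: "'a \<times> 'b::metric_space \<Rightarrow> real" and s :: "nat \<Rightarrow> 'b"
  assumes "prob_space \<mu>" "prob_space \<nu>" and \<nu>: "sets \<nu> = sets borel"
    and s: "emeasure \<nu> (closure (range s)) = 1"
    and c_meas: "\<And>y. (\<lambda>x. c (x, y)) \<in> borel_measurable \<mu>"
    and c_cont: "\<And>x. continuous_on UNIV (\<lambda>y. c (x, y))"
    and c_bounds: "\<And>z. 0 \<le> c z" "\<And>z. c z \<le> M"
    and B: "\<And>P. P \<in> couplings \<mu> \<nu> \<Longrightarrow> (\<integral>z. c z \<partial>completion P) \<le> B"
    and "\<epsilon> > 0"
  obtains f g where "integrable \<mu> f" "integrable \<nu> g"
    and "\<And>x. 0 \<le> f x" "\<And>y. 0 \<le> g y"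
    and "\<And>x y. x \<in> space \<mu> \<Longrightarrow> min M (c (x, y)) \<le> f x + g y"
    and "(\<integral>x. f x \<partial>\<mu>) + (\<integral>y. g y \<partial>\<nu>) \<le> B + \<epsilon>"
proof -
  interpret M: prob_space \<mu> by fact
  interpret N: prob_space \<nu> by fact
  have M: "0 \<le> M" using c_bounds order_trans by blast
  define S where "S = closure (range s)"
  have S[measurable]: "S \<in> sets \<nu>" using \<nu> by (simp add: S_def)
  have spN: "space \<nu> = UNIV" using sets_eq_imp_space_eq[OF \<nu>] by simp
  obtain c' where c'[measurable]: "c' \<in> borel_measurable (\<mu> \<Otimes>\<^sub>M \<nu>)"
    and c'_eq: "\<And>x y. y \<in> S \<Longrightarrow> c (x, y) = c' (x, y)"
  proof (rule product_measurable_version[where \<nu>=\<nu> and \<mu>=\<mu> and s=s and c=c and b=0, folded S_def])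
    fix c' assume "c' \<in> borel_measurable (\<mu> \<Otimes>\<^sub>M \<nu>)"
      "\<And>x y. y \<in> S \<Longrightarrow> c (x, y) = c' (x, y)"
    then show thesis by (rule that)
  qed (rule \<nu> c_meas c_cont c_bounds)+
  obtain h :: "'a \<Rightarrow> nat set \<Rightarrow> real" and \<kappa> where
    \<kappa>: "\<And>n. \<kappa> n \<in> measurable \<nu> (count_space (Pow {..<n}))"
    and h: "\<And>k. (\<lambda>x. h x k) \<in> borel_measurable \<mu>"
    and h_bounds: "\<And>x k. 0 \<le> h x k" "\<And>x k. h x k \<le> M"
    and h_mono: "\<And>n x y. h x (\<kappa> n y) \<le> h x (\<kappa> (Suc n) y)"
    and h_le: "\<And>n x y. y \<in> S \<Longrightarrow> h x (\<kappa> n y) \<le> c (x, y)"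
    and lim: "\<And>x y. y \<in> S \<Longrightarrow> (\<lambda>n. h x (\<kappa> n y)) \<longlonglongrightarrow> c (x, y)"
  proof (rule semidiscrete_approximation[where \<nu>=\<nu> and \<mu>=\<mu> and s=s and M=M and c=c, folded S_def])
    fix h :: "'a \<Rightarrow> nat set \<Rightarrow> real" and \<kappa>
    assume "\<And>n. \<kappa> n \<in> measurable \<nu> (count_space (Pow {..<n}))"
      "\<And>k. (\<lambda>x. h x k) \<in> borel_measurable \<mu>"
      "\<And>x k. 0 \<le> h x k"
      "\<And>x k. h x k \<le> M"
      "\<And>n x y. h x (\<kappa> n y) \<le> h x (\<kappa> (Suc n) y)"
      "\<And>n x y. y \<in> S \<Longrightarrow> h x (\<kappa> n y) \<le> c (x, y)"
      "\<And>x y. y \<in> S \<Longrightarrow> (\<lambda>n. h x (\<kappa> n y)) \<longlonglongrightarrow> c (x, y)"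
    then show thesis by (rule that)
  qed (rule \<nu> c_meas c_cont c_bounds)+
  define C where "C n z = h (fst z) (\<kappa> n (snd z))" for n z
  have C_mono: "C n z \<le> C (Suc n) z" and C_le: "C n z \<le> M" for n z
    by (simp_all add: C_def h_mono h_bounds)
  have ex: "\<exists>f g. f \<in> borel_measurable \<mu> \<and> g \<in> borel_measurable \<nu> \<and>
      (\<forall>x\<in>space \<mu>. f x \<in> {0..M}) \<and> (\<forall>y\<in>space \<nu>. g y \<in> {0..M}) \<and>
      (\<forall>x\<in>space \<mu>. \<forall>y\<in>space \<nu>. C n (x, y) \<le> f x + g y) \<and>
      (\<integral>x. f x \<partial>\<mu>) + (\<integral>y. g y \<partial>\<nu>) \<le> B + \<epsilon>" for n
  proof -
    obtain f g P where fg: "f \<in> borel_measurable \<mu>" "g \<in> borel_measurable \<nu>"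
      "\<And>x. x \<in> space \<mu> \<Longrightarrow> f x \<in> {0..M}" "\<And>y. y \<in> space \<nu> \<Longrightarrow> g y \<in> {0..M}"
      "\<And>x y. x \<in> space \<mu> \<Longrightarrow> y \<in> space \<nu> \<Longrightarrow> h x (\<kappa> n y) \<le> f x + g y"
      and P: "P \<in> couplings \<mu> \<nu>"
      and val: "(\<integral>x. f x \<partial>\<mu>) + (\<integral>y. g y \<partial>\<nu>) \<le> (\<integral>z. h (fst z) (\<kappa> n (snd z)) \<partial>P) + \<epsilon>"
    proof (rule semidiscrete_duality[where \<mu>=\<mu> and \<nu>=\<nu> and K="Pow {..<n}" and h=h and M=M, OF assms(1,2) _ _ \<kappa>[of n] h h_bounds \<open>\<epsilon> > 0\<close>])
      fix f g P
      assume "f \<in> borel_measurable \<mu>" "g \<in> borel_measurable \<nu>"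
        "\<And>x. x \<in> space \<mu> \<Longrightarrow> f x \<in> {0..M}" "\<And>y. y \<in> space \<nu> \<Longrightarrow> g y \<in> {0..M}"
        "\<And>x y. x \<in> space \<mu> \<Longrightarrow> y \<in> space \<nu> \<Longrightarrow> h x (\<kappa> n y) \<le> f x + g y"
        "P \<in> couplings \<mu> \<nu>"
        "(\<integral>x. f x \<partial>\<mu>) + (\<integral>y. g y \<partial>\<nu>) \<le> (\<integral>z. h (fst z) (\<kappa> n (snd z)) \<partial>P) + \<epsilon>"
      then show thesis by (rule that)
    qed auto
    interpret Q: prob_space P using P by (simp add: couplings_def)
    have [measurable_cong]: "sets P = sets (\<mu> \<Otimes>\<^sub>M \<nu>)" using P by (simp add: couplings_def)
    have PS: "AE z in P. snd z \<in> S"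
      by (rule coupling_AE_snd[OF P assms(2) S s[folded S_def]])
    have Pc: "(\<integral>z. c z \<partial>completion P) = (\<integral>z. c' z \<partial>P)"
      by (rule coupling_completion[OF P c' PS]) (rule c'_eq)
    have [measurable]: "C n \<in> borel_measurable (\<mu> \<Otimes>\<^sub>M \<nu>)"
      unfolding C_def using \<kappa> h by (intro measurable_finite_family) auto
    have i1: "integrable P (C n)"
      using h_bounds by (intro Q.integrable_const_bound[where B=M]) (auto simp: C_def)
    have "AE z in P. 0 \<le> c' z \<and> c' z \<le> M \<and> C n z \<le> c' z"
      using PS
    proof (rule AE_mp, intro AE_I2 impI)
      fix z :: "'a \<times> 'b" assume "snd z \<in> S"
      then show "0 \<le> c' z \<and> c' z \<le> M \<and> C n z \<le> c' z"
        using c'_eq[of "snd z" "fst z"] c_bounds[of z] h_le[of "snd z" "fst z" n] by (simp add: C_def)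
    qed
    then have ae: "AE z in P. norm (c' z) \<le> M" "AE z in P. C n z \<le> c' z" by auto
    have i2: "integrable P c'"
      using ae(1) by (intro Q.integrable_const_bound[where B=M]) auto
    have "(\<integral>z. C n z \<partial>P) \<le> (\<integral>z. c' z \<partial>P)" by (intro integral_mono_AE i1 i2 ae)
    also have "\<dots> \<le> B" using B[OF P] Pc by simp
    finally show ?thesis
      using fg val by (intro exI[of _ f] exI[of _ g]) (auto simp: C_def)
  qed
  obtain f g where fg[measurable]: "f \<in> borel_measurable \<mu>" "g \<in> borel_measurable \<nu>"
    and fgb: "\<And>x. f x \<in> {0..M}" "\<And>y. g y \<in> {0..M}"
    and dom: "\<And>n x y. x \<in> space \<mu> \<Longrightarrow> y \<in> space \<nu> \<Longrightarrow> C n (x, y) \<le> f x + g y"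
    and val: "(\<integral>x. f x \<partial>\<mu>) + (\<integral>y. g y \<partial>\<nu>) \<le> B + \<epsilon>"
  proof (rule dual_pairs_limit[where \<mu>=\<mu> and \<nu>=\<nu> and M=M and C=C and B="B + \<epsilon>"])
    fix f g assume "f \<in> borel_measurable \<mu>" "g \<in> borel_measurable \<nu>"
      "\<And>x. f x \<in> {0..M}" "\<And>y. g y \<in> {0..M}"
      "\<And>n x y. x \<in> space \<mu> \<Longrightarrow> y \<in> space \<nu> \<Longrightarrow> C n (x, y) \<le> f x + g y"
      "(\<integral>x. f x \<partial>\<mu>) + (\<integral>y. g y \<partial>\<nu>) \<le> B + \<epsilon>"
    then show thesis by (rule that)
  qed (rule assms(1,2) M ex C_mono C_le)+
  \<comment> \<open>Off \<open>S\<close> the approximations say nothing about \<open>c\<close>, so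
    \<open>g\<close> is replaced by the upper bound \<open>M\<close> there, which leaves the
    integral unchanged.\<close>
  define g' where "g' y = (if y \<in> S then g y else M)" for y
  have [measurable]: "g' \<in> borel_measurable \<nu>" unfolding g'_def by measurable
  have "AE y in \<nu>. y \<in> S"
    using S s by (simp add: S_def N.emeasure_eq_measure N.AE_in_set_eq_1)
  then have "(\<integral>y. g' y \<partial>\<nu>) = (\<integral>y. g y \<partial>\<nu>)"
    by (intro integral_cong_AE) (auto simp: g'_def)
  moreover have "min M (c (x, y)) \<le> f x + g' y" if x: "x \<in> space \<mu>" for x y
  proof (cases "y \<in> S")
    case True
    have "c (x, y) \<le> f x + g y"
      using lim[OF True, of x] dom[OF x, of y] by (intro LIMSEQ_le_const2) (auto simp: C_def spN)
    then show ?thesis using True by (simp add: g'_def)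
  next
    case False
    then show ?thesis using fgb(1)[of x] by (auto simp: g'_def min_def)
  qed
  moreover have "integrable \<mu> f" "integrable \<nu> g'"
    using fgb M by (auto intro!: M.integrable_const_bound[where B=M] N.integrable_const_bound[where B=M] simp: g'_def)
  ultimately show thesis
    using val fgb M by (intro that[of f g']) (auto simp: g'_def)
qed

section \<open>From bounded to unbounded costs\<close>

lemma integral_excess_tendsto_0:
  fixes f :: "'a \<Rightarrow> real"
  assumes f: "integrable M f"
  shows "(\<lambda>k. \<integral>x. max 0 (f x - real k) \<partial>M) \<longlonglongrightarrow> 0"
proof -
  have [measurable]: "f \<in> borel_measurable M" using f by auto
  have "(\<lambda>k. \<integral>x. max 0 (f x - real k) \<partial>M) \<longlonglongrightarrow> (\<integral>x. 0 \<partial>M)"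
  proof (rule integral_dominated_convergence[where w="\<lambda>x. \<bar>f x\<bar>"])
    show "integrable M (\<lambda>x. \<bar>f x\<bar>)" using f by simp
    show "AE x in M. (\<lambda>k. max 0 (f x - real k)) \<longlonglongrightarrow> 0"
    proof (intro AE_I2)
      fix x
      obtain k0 :: nat where "f x \<le> real k0" using real_arch_simple by blast
      then have "eventually (\<lambda>k. max 0 (f x - real k) = 0) sequentially"
        by (intro eventually_sequentiallyI[of k0]) simp
      then show "(\<lambda>k. max 0 (f x - real k)) \<longlonglongrightarrow> 0" by (rule tendsto_eventually)
    qed
    show "AE x in M. norm (max 0 (f x - real k)) \<le> \<bar>f x\<bar>" for k by (intro AE_I2) (auto simp: max_def)
  qed auto
  then show ?thesis by simp
qed

text \<open>The closure of a countable dense subset of \<open>S\<close> contains \<open>S\<close>,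
  and being closed it is measurable.\<close>

lemma separable_measure_dense_sequence:
  fixes \<nu> :: "'b::metric_space measure"
  assumes "prob_space \<nu>" and \<nu>: "sets \<nu> = sets borel" and "separable_measure \<nu>"
  obtains s :: "nat \<Rightarrow> 'b" where "emeasure \<nu> (closure (range s)) = 1"
proof -
  interpret prob_space \<nu> by fact
  obtain S where S: "S \<in> sets borel" "separable_space (top_of_set S)" "emeasure \<nu> S = 1"
    using assms(3) by (auto simp: separable_measure_def)
  then obtain D where D: "countable D" "D \<subseteq> S" "top_of_set S closure_of D = S"
    by (auto simp: separable_space_def)
  have "S \<inter> closure (S \<inter> D) = S" using D(3) by (simp add: closure_of_subtopology)
  then have SD: "S \<subseteq> closure D" using closure_mono[of "S \<inter> D" D] by auto
  \<comment> \<open>An empty \<open>D\<close> would force \<open>S\<close> to be empty, against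
    measure one; \<open>from_nat_into\<close> enumerates nonempty countable sets.\<close>
  have "D \<noteq> {}" using SD S(3) by auto
  then have r: "range (from_nat_into D) = D" using D(1) by (rule range_from_nat_into)
  have "emeasure \<nu> S \<le> emeasure \<nu> (closure D)" using SD \<nu> by (intro emeasure_mono) auto
  then have "emeasure \<nu> (closure D) = 1" using S(3) emeasure_le_1[of "closure D"] by auto
  then show thesis using r by (intro that[of "from_nat_into D"]) simp
qed

text \<open>Subtracting the constant \<open>b\<close> makes the cost nonnegative and keeps
  continuity in \<open>y\<close>, which subtracting the merely measurable \<open>g1\<close> might
  destroy. Truncation from above stays below the cost, so the primal supremum also bounds the
  truncated costs, while the majorant \<open>f2 + g2\<close> controls what the dual pair must
  add.\<close>

lemma primal_sup_eq_dual_inf: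
  fixes \<mu> :: "'a measure" and \<nu> :: "'b::metric_space measure" and c :: "'a \<times> 'b \<Rightarrow> real"
  assumes \<mu>: "prob_space \<mu>" and \<nu>: "prob_space \<nu>" "sets \<nu> = sets borel"
    and int: "integrable \<mu> f1" "integrable \<mu> f2" "integrable \<nu> g1" "integrable \<nu> g2"
    and lower: "\<And>x y. f1 x + g1 y \<le> c (x, y)" and upper: "\<And>x y. c (x, y) \<le> f2 x + g2 y"
    and c_meas: "\<And>y. (\<lambda>x. c (x, y)) \<in> borel_measurable \<mu>"
    and c_cont: "\<And>x. continuous_on UNIV (\<lambda>y. c (x, y))"
    and bdd: "bdd_below (range c)" and sep: "separable_measure \<nu>"
  shows "primal_sup \<mu> \<nu> c = dual_inf \<mu> \<nu> c"
proof -
  interpret M: prob_space \<mu> by fact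
  interpret N: prob_space \<nu> by fact
  obtain b where b: "\<And>z. b \<le> c z" using bdd by (auto simp: bdd_below_def)
  have sp: "space \<nu> = UNIV" using sets_eq_imp_space_eq[OF \<nu>(2)] by simp
  obtain s :: "nat \<Rightarrow> 'b" where s: "emeasure \<nu> (closure (range s)) = 1"
    using separable_measure_dense_sequence[OF \<nu> sep] by blast
  define S where "S = closure (range s)"
  have S: "S \<in> sets \<nu>" using \<nu>(2) by (simp add: S_def)
  obtain c' where c'[measurable]: "c' \<in> borel_measurable (\<mu> \<Otimes>\<^sub>M \<nu>)"
    and c'_eq: "\<And>x y. y \<in> S \<Longrightarrow> c (x, y) = c' (x, y)"
  proof (rule product_measurable_version[where \<nu>=\<nu> and \<mu>=\<mu> and s=s and c=c and b=b, folded S_def])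
    fix c' assume "c' \<in> borel_measurable (\<mu> \<Otimes>\<^sub>M \<nu>)"
      "\<And>x y. y \<in> S \<Longrightarrow> c (x, y) = c' (x, y)"
    then show thesis by (rule that)
  qed (rule \<nu> c_meas c_cont b)+
  note PS = coupling_AE_snd[OF _ \<nu>(1) S s[folded S_def]]
  have Pm: "c' \<in> borel_measurable P" if "P \<in> couplings \<mu> \<nu>" for P
  proof -
    have [measurable_cong]: "sets P = sets (\<mu> \<Otimes>\<^sub>M \<nu>)" using that by (simp add: couplings_def)
    show ?thesis by measurable
  qed
  have ae: "AE z in P. f1 (fst z) + g1 (snd z) \<le> c' z" "AE z in P. c' z \<le> f (fst z) + g (snd z)"
    if P: "P \<in> couplings \<mu> \<nu>" and dom: "\<And>x y. x \<in> space \<mu> \<Longrightarrow> c (x, y) \<le> f x + g y" for P f g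
  proof -
    have spP: "space P = space \<mu> \<times> space \<nu>"
      using P sets_eq_imp_space_eq[of P "\<mu> \<Otimes>\<^sub>M \<nu>"] by (simp add: couplings_def space_pair_measure)
    have "f1 (fst z) + g1 (snd z) \<le> c' z \<and> c' z \<le> f (fst z) + g (snd z)" if "snd z \<in> S" "z \<in> space P" for z
      using lower[of "fst z" "snd z"] dom[of "fst z" "snd z"] c'_eq[of "snd z" "fst z"] that by (auto simp: spP)
    then have "AE z in P. snd z \<in> S \<longrightarrow> f1 (fst z) + g1 (snd z) \<le> c' z \<and> c' z \<le> f (fst z) + g (snd z)"
      by (intro AE_I2 impI)
    with PS[OF P] have "AE z in P. f1 (fst z) + g1 (snd z) \<le> c' z \<and> c' z \<le> f (fst z) + g (snd z)"
      by eventually_elim (rule mp)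
    then show "AE z in P. f1 (fst z) + g1 (snd z) \<le> c' z" "AE z in P. c' z \<le> f (fst z) + g (snd z)"
      by auto
  qed
  have c'_int: "integrable P c'" if P: "P \<in> couplings \<mu> \<nu>" for P
  proof (rule Bochner_Integration.integrable_bound)
    show "integrable P (\<lambda>z. \<bar>f1 (fst z) + g1 (snd z)\<bar> + \<bar>f2 (fst z) + g2 (snd z)\<bar>)"
      using coupling_integral_sum(1)[OF P int(1,3)] coupling_integral_sum(1)[OF P int(2,4)] by simp
    show "AE z in P. norm (c' z) \<le> norm (\<bar>f1 (fst z) + g1 (snd z)\<bar> + \<bar>f2 (fst z) + g2 (snd z)\<bar>)"
      using ae[OF P upper] by eventually_elim auto
  qed (rule Pm[OF P])
  have Pc: "(\<integral>z. c z \<partial>completion P) = (\<integral>z. c' z \<partial>P)" if P: "P \<in> couplings \<mu> \<nu>" for P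
    by (rule coupling_completion[OF P c' PS[OF P]]) (rule c'_eq)
  have weak: "(\<integral>z. c z \<partial>completion P) \<le> (\<integral>x. f x \<partial>\<mu>) + (\<integral>y. g y \<partial>\<nu>)"
    if P: "P \<in> couplings \<mu> \<nu>" and fg: "integrable \<mu> f" "integrable \<nu> g"
      and dom: "\<And>x y. x \<in> space \<mu> \<Longrightarrow> c (x, y) \<le> f x + g y" for P f g
  proof -
    have "(\<integral>z. c' z \<partial>P) \<le> (\<integral>z. f (fst z) + g (snd z) \<partial>P)"
      by (rule integral_mono_AE[OF c'_int[OF P] coupling_integral_sum(1)[OF P fg] ae(2)[OF P dom]])
    then show ?thesis using Pc[OF P] coupling_integral_sum(2)[OF P fg] by simp
  qed
  \<comment> \<open>The zero density extends to a coupling, namely the product measure; the real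
    supremum over an empty set would carry no meaning.\<close>
  have ne: "couplings \<mu> \<nu> \<noteq> {}"
  proof -
    obtain P where "P \<in> couplings \<mu> \<nu>"
      by (rule subcoupling_extends[of \<mu> \<nu> "\<lambda>_. 0"]) (auto intro: \<mu> \<nu>)
    then show ?thesis by blast
  qed
  have bddA: "bdd_above ((\<lambda>P. \<integral>z. c z \<partial>completion P) ` couplings \<mu> \<nu>)"
    using weak[OF _ int(2,4) upper] by (rule bdd_aboveI2)
  define \<alpha> where "\<alpha> = primal_sup \<mu> \<nu> c"
  have \<alpha>: "(\<integral>z. c z \<partial>completion P) \<le> \<alpha>" if "P \<in> couplings \<mu> \<nu>" for P
    unfolding \<alpha>_def primal_sup_def by (rule cSUP_upper[OF that bddA])
  define D where "D = {(\<integral>x. f x \<partial>\<mu>) + (\<integral>y. g y \<partial>\<nu>) | f g.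
            integrable \<mu> f \<and> integrable \<nu> g \<and> (\<forall>x\<in>space \<mu>. \<forall>y\<in>space \<nu>. c (x, y) \<le> f x + g y)}"
  have D: "dual_inf \<mu> \<nu> c = Inf D" by (simp add: dual_inf_def D_def)
  have \<alpha>_le: "\<alpha> \<le> d" if "d \<in> D" for d
    unfolding \<alpha>_def primal_sup_def using that weak by (intro cSUP_least ne) (auto simp: D_def sp)
  have D_ne: "D \<noteq> {}" using int upper by (auto simp: D_def)
  \<comment> \<open>Truncate \<open>c - b\<close> at level \<open>2 k\<close>; the excess is at most \<open>(f2 - b - k)\<^sup>+ + (g2 - k)\<^sup>+\<close>, whose integral
    tends to zero.\<close>
  have "Inf D \<le> \<alpha> + \<epsilon>" if "\<epsilon> > 0" for \<epsilon>
  proof (rule LIMSEQ_le_const)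
    have "(\<lambda>k. (\<alpha> + \<epsilon>) + ((\<integral>x. max 0 (f2 x - b - real k) \<partial>\<mu>) + (\<integral>y. max 0 (g2 y - real k) \<partial>\<nu>)))
        \<longlonglongrightarrow> (\<alpha> + \<epsilon>) + (0 + 0)"
      using int by (intro tendsto_add tendsto_const integral_excess_tendsto_0) auto
    then show "(\<lambda>k. (\<alpha> + \<epsilon>) + ((\<integral>x. max 0 (f2 x - b - real k) \<partial>\<mu>) + (\<integral>y. max 0 (g2 y - real k) \<partial>\<nu>)))
        \<longlonglongrightarrow> \<alpha> + \<epsilon>" by simp
    have "Inf D \<le> (\<alpha> + \<epsilon>) + ((\<integral>x. max 0 (f2 x - b - real k) \<partial>\<mu>) + (\<integral>y. max 0 (g2 y - real k) \<partial>\<nu>))" for k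
    proof -
      define t where "t z = min (c z - b) (2 * real k)" for z
      have t1: "(\<lambda>x. t (x, y)) \<in> borel_measurable \<mu>" for y unfolding t_def using c_meas by measurable
      have t2: "continuous_on UNIV (\<lambda>y. t (x, y))" for x unfolding t_def using c_cont by (intro continuous_intros)
      have t3: "0 \<le> t z" "t z \<le> 2 * real k" for z using b[of z] by (auto simp: t_def)
      have t4: "(\<integral>z. t z \<partial>completion P) \<le> \<alpha> - b" if P: "P \<in> couplings \<mu> \<nu>" for P
      proof -
        interpret Q: prob_space P using P by (simp add: couplings_def)
        have "(\<integral>z. t z \<partial>completion P) = (\<integral>z. min (c' z - b) (2 * real k) \<partial>P)"
          by (rule coupling_completion[OF P _ PS[OF P]]) (auto simp: t_def c'_eq)
        also have "\<dots> \<le> (\<integral>z. c' z - b \<partial>P)" using c'_int[OF P] by (intro integral_mono) auto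
        also have "\<dots> = (\<integral>z. c z \<partial>completion P) - b" using c'_int[OF P] by (simp add: Pc[OF P] Q.prob_space)
        also have "\<dots> \<le> \<alpha> - b" using \<alpha>[OF P] by simp
        finally show ?thesis .
      qed
      obtain f g where fg: "integrable \<mu> f" "integrable \<nu> g"
        and fg0: "\<And>x. 0 \<le> f x" "\<And>y. 0 \<le> g y"
        and dom: "\<And>x y. x \<in> space \<mu> \<Longrightarrow> min (2 * real k) (t (x, y)) \<le> f x + g y"
        and val: "(\<integral>x. f x \<partial>\<mu>) + (\<integral>y. g y \<partial>\<nu>) \<le> \<alpha> - b + \<epsilon>"
      proof (rule bounded_dual_pair[where \<mu>=\<mu> and \<nu>=\<nu> and s=s and c=t and M="2 * real k" and B="\<alpha> - b" and \<epsilon>=\<epsilon>,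
            OF \<mu> \<nu> s t1 t2 t3 t4 \<open>\<epsilon> > 0\<close>])
        fix f g assume "integrable \<mu> f" "integrable \<nu> g" "\<And>x. 0 \<le> f x" "\<And>y. 0 \<le> g y"
          "\<And>x y. x \<in> space \<mu> \<Longrightarrow> min (2 * real k) (t (x, y)) \<le> f x + g y"
          "(\<integral>x. f x \<partial>\<mu>) + (\<integral>y. g y \<partial>\<nu>) \<le> \<alpha> - b + \<epsilon>"
        then show thesis by (rule that)
      qed
      define F where "F x = f x + b + max 0 (f2 x - b - real k)" for x
      define G where "G y = g y + max 0 (g2 y - real k)" for y
      \<comment> \<open>Where the cut is active, \<open>f x + g y \<ge> 2 * k\<close>, while
        \<open>f2 x - b\<close> and \<open>g2 y\<close> exceed \<open>k\<close> by at most the added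
        positive parts. Elsewhere \<open>c - b \<le> f + g\<close> already.\<close>
      have "c (x, y) \<le> F x + G y" if "x \<in> space \<mu>" for x y
        using dom[OF that, of y] fg0(1)[of x] fg0(2)[of y] upper[of x y]
        by (auto simp: F_def G_def t_def min_def max_def split: if_splits)
      moreover have "integrable \<mu> F" "integrable \<nu> G" using fg int by (auto simp: F_def[abs_def] G_def[abs_def])
      ultimately have "(\<integral>x. F x \<partial>\<mu>) + (\<integral>y. G y \<partial>\<nu>) \<in> D" unfolding D_def by blast
      then have "Inf D \<le> (\<integral>x. F x \<partial>\<mu>) + (\<integral>y. G y \<partial>\<nu>)"
        using \<alpha>_le by (intro cInf_lower bdd_belowI)
      also have "\<dots> = (\<integral>x. f x \<partial>\<mu>) + (\<integral>y. g y \<partial>\<nu>) + b +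
          ((\<integral>x. max 0 (f2 x - b - real k) \<partial>\<mu>) + (\<integral>y. max 0 (g2 y - real k) \<partial>\<nu>))"
        using fg int by (simp add: F_def G_def M.prob_space)
      finally show ?thesis using val by simp
    qed
    then show "\<exists>N. \<forall>n\<ge>N. Inf D \<le> (\<alpha> + \<epsilon>) + ((\<integral>x. max 0 (f2 x - b - real n) \<partial>\<mu>) + (\<integral>y. max 0 (g2 y - real n) \<partial>\<nu>))"
      by blast
  qed
  then have "Inf D \<le> \<alpha>" by (rule field_le_epsilon)
  moreover have "\<alpha> \<le> Inf D" using \<alpha>_le D_ne by (intro cInf_greatest) auto
  ultimately show ?thesis using D by (simp add: \<alpha>_def)
qed

section \<open>Exchange of supremum and infimum by change of sign\<close>

lemma primal_inf_uminus: "primal_inf \<mu> \<nu> c = - primal_sup \<mu> \<nu> (\<lambda>z. - c z)"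
  \<comment> \<open>On the reals \<open>Inf\<close> is defined as the negated \<open>Sup\<close> of
    the negated set, so empty and unbounded sets are covered too.\<close>
  by (simp add: primal_inf_def primal_sup_def Inf_real_def image_image)

lemma dual_sup_uminus: "dual_sup \<mu> \<nu> c = - dual_inf \<mu> \<nu> (\<lambda>z. - c z)"
proof -
  let ?A = "{(\<integral>x. f x \<partial>\<mu>) + (\<integral>y. g y \<partial>\<nu>) | f g. integrable \<mu> f \<and> integrable \<nu> g \<and>
      (\<forall>x\<in>space \<mu>. \<forall>y\<in>space \<nu>. f x + g y \<le> c (x, y))}"
  let ?B = "{(\<integral>x. f x \<partial>\<mu>) + (\<integral>y. g y \<partial>\<nu>) | f g. integrable \<mu> f \<and> integrable \<nu> g \<and>
      (\<forall>x\<in>space \<mu>. \<forall>y\<in>space \<nu>. - c (x, y) \<le> f x + g y)}"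
  have "?A = uminus ` ?B"
  proof (intro set_eqI iffI)
    fix r assume "r \<in> ?A"
    then obtain f g where fg: "r = (\<integral>x. f x \<partial>\<mu>) + (\<integral>y. g y \<partial>\<nu>)" "integrable \<mu> f" "integrable \<nu> g"
      "\<forall>x\<in>space \<mu>. \<forall>y\<in>space \<nu>. f x + g y \<le> c (x, y)" by blast
    moreover have "- c (x, y) \<le> - f x + - g y" if "x \<in> space \<mu>" "y \<in> space \<nu>" for x y
      using fg(4) that by fastforce
    ultimately have "- r \<in> ?B"
      by (intro CollectI exI[of _ "\<lambda>x. - f x"] exI[of _ "\<lambda>y. - g y"]) simp
    then show "r \<in> uminus ` ?B" by (intro image_eqI[of _ _ "- r"]) simp_all
  next
    fix r assume "r \<in> uminus ` ?B"
    then obtain f g where fg: "r = - ((\<integral>x. f x \<partial>\<mu>) + (\<integral>y. g y \<partial>\<nu>))" "integrable \<mu> f" "integrable \<nu> g"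
      "\<forall>x\<in>space \<mu>. \<forall>y\<in>space \<nu>. - c (x, y) \<le> f x + g y" by blast
    moreover have "- f x + - g y \<le> c (x, y)" if "x \<in> space \<mu>" "y \<in> space \<nu>" for x y
      using fg(4) that by fastforce
    ultimately show "r \<in> ?A"
      by (intro CollectI exI[of _ "\<lambda>x. - f x"] exI[of _ "\<lambda>y. - g y"]) simp
  qed
  then show ?thesis by (simp add: dual_sup_def dual_inf_def Inf_real_def image_image)
qed

theorem theorem8:
  fixes \<mu> :: "'a::metric_space measure" and \<nu> :: "'b::metric_space measure"
    and c :: "'a \<times> 'b \<Rightarrow> real"
    and f1 f2 :: "'a \<Rightarrow> real" and g1 g2 :: "'b \<Rightarrow> real"
  assumes "prob_space \<mu>" and "sets \<mu> = sets borel"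
    and "prob_space \<nu>" and "sets \<nu> = sets borel"
    and "integrable \<mu> f1" and "integrable \<mu> f2"
    and "integrable \<nu> g1" and "integrable \<nu> g2"
    and "\<And>x y. f1 x + g1 y \<le> c (x, y)"
    and "\<And>x y. c (x, y) \<le> f2 x + g2 y"
    and "\<And>y. (\<lambda>x. c (x, y)) \<in> borel_measurable borel"
    and "\<And>x. continuous_on UNIV (\<lambda>y. c (x, y))"
  shows "(bdd_below (range c) \<and> separable_measure \<nu> \<longrightarrow>
            primal_sup \<mu> \<nu> c = dual_inf \<mu> \<nu> c) \<and>
         (bdd_above (range c) \<and> separable_measure \<nu> \<longrightarrow>
            primal_inf \<mu> \<nu> c = dual_sup \<mu> \<nu> c) \<and>
         (bounded (range c) \<and> separable_measure \<nu> \<longrightarrow>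
            primal_inf \<mu> \<nu> c = dual_sup \<mu> \<nu> c \<and>
            primal_sup \<mu> \<nu> c = dual_inf \<mu> \<nu> c)"
proof -
  have m: "(\<lambda>x. c (x, y)) \<in> borel_measurable \<mu>" for y
    using assms(11)[of y] by (simp cong: measurable_cong_sets add: assms(2))
  have sup: "primal_sup \<mu> \<nu> c = dual_inf \<mu> \<nu> c" if "bdd_below (range c)" "separable_measure \<nu>"
    by (rule primal_sup_eq_dual_inf[OF assms(1,3-10) m assms(12) that])
  have inf: "primal_inf \<mu> \<nu> c = dual_sup \<mu> \<nu> c" if bdd: "bdd_above (range c)" and sep: "separable_measure \<nu>"
  proof -
    obtain u where u: "\<And>z. c z \<le> u" using bdd by (auto simp: bdd_above_def)
    have "primal_sup \<mu> \<nu> (\<lambda>z. - c z) = dual_inf \<mu> \<nu> (\<lambda>z. - c z)"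
    proof (rule primal_sup_eq_dual_inf[where ?f1.0="\<lambda>x. - f2 x" and ?f2.0="\<lambda>x. - f1 x"
          and ?g1.0="\<lambda>y. - g2 y" and ?g2.0="\<lambda>y. - g1 y"])
      show "- f2 x + - g2 y \<le> - c (x, y)" for x y using assms(10)[of x y] by linarith
      show "- c (x, y) \<le> - f1 x + - g1 y" for x y using assms(9)[of x y] by linarith
      show "(\<lambda>x. - c (x, y)) \<in> borel_measurable \<mu>" for y using m by measurable
      show "continuous_on UNIV (\<lambda>y. - c (x, y))" for x using assms(12) by (intro continuous_intros)
      show "bdd_below (range (\<lambda>z. - c z))" using u by (intro bdd_belowI2[where m="- u"]) simp
    qed (use assms(1,3-8) sep in auto)
    then show ?thesis by (simp add: primal_inf_uminus dual_sup_uminus)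
  qed
  show ?thesis
  proof (intro conjI impI; elim conjE)
    assume "bounded (range c)" and sep: "separable_measure \<nu>"
    then have "bdd_above (range c)" "bdd_below (range c)"
      by (auto intro: bounded_imp_bdd_above bounded_imp_bdd_below)
    then show "primal_inf \<mu> \<nu> c = dual_sup \<mu> \<nu> c" "primal_sup \<mu> \<nu> c = dual_inf \<mu> \<nu> c"
      using sup inf sep by iprover+
  qed (rule sup inf; assumption)+
qed

end
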